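(* MinPOHPP and MinPOHCP can be solved in $2^k\cdot n^{O(1)}$ time on an $n$-vertex graph with feedback edge set number $k$.
   Context: All graphs are finite and simple. A partial order $\pi$ on $V(G)$ is a reflexive, antisymmetric, transitive relation. An ordered Hamiltonian path $(v_1,\dots,v_n)$ of $G$ (each vertex exactly once, consecutive vertices adjacent) is $\pi$-extending if $(v_i,v_j)\in\pi$ implies $i\le j$. MinPOHPP: given a graph $G$, a partial order $\pi$ on $V(G)$ and a cost function $c:E(G)\to\mathbb{R}$, find a $\pi$-extending ordered Hamiltonian path of minimum total edge cost (or report that none exists). MinPOHCP: the same, but for $\pi$-extending ordered Hamiltonian paths $(v_1,\dots,v_n)$ with $v_1v_n\in E(G)$, whose cost includes the edge $v_nv_1$ (a minimum-cost such cycle). The feedback edge set number of $G$ is the minimum number of edges whose deletion makes $G$ acyclic. *)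

theory Defs
  imports Complex_Main "HOL-Library.Landau_Symbols"
begin

section \<open>Graphs and feedback edge sets\<close>

definition simple_graph :: "'a set \<Rightarrow> 'a set set \<Rightarrow> bool" where
  "simple_graph V E \<longleftrightarrow> finite V \<and> (\<forall>e\<in>E. \<exists>u\<in>V. \<exists>v\<in>V. u \<noteq> v \<and> e = {u, v})"

definition graph_cycle :: "'a set set \<Rightarrow> 'a list \<Rightarrow> bool" where
  "graph_cycle E vs \<longleftrightarrow>
     3 \<le> length vs \<and> distinct vs \<and>
     (\<forall>i. Suc i < length vs \<longrightarrow> {vs ! i, vs ! Suc i} \<in> E) \<and> {last vs, hd vs} \<in> E"

definition acyclic_graph :: "'a set set \<Rightarrow> bool" where
  "acyclic_graph E \<longleftrightarrow> (\<nexists>vs. graph_cycle E vs)"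

definition feedback_edge_number :: "'a set set \<Rightarrow> nat" where
  "feedback_edge_number E = (LEAST k. \<exists>F\<subseteq>E. card F = k \<and> acyclic_graph (E - F))"


section \<open>Partially ordered Hamiltonian paths and cycles\<close>

definition hamiltonian_path :: "'a set \<Rightarrow> 'a set set \<Rightarrow> 'a list \<Rightarrow> bool" where
  "hamiltonian_path V E vs \<longleftrightarrow>
     distinct vs \<and> set vs = V \<and> (\<forall>i. Suc i < length vs \<longrightarrow> {vs ! i, vs ! Suc i} \<in> E)"

definition extending :: "('a \<times> 'a) set \<Rightarrow> 'a list \<Rightarrow> bool" where
  "extending \<pi> vs \<longleftrightarrow>
     (\<forall>i<length vs. \<forall>j<length vs. (vs ! i, vs ! j) \<in> \<pi> \<longrightarrow> i \<le> j)"

definition path_cost :: "('a set \<Rightarrow> real) \<Rightarrow> 'a list \<Rightarrow> real" where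
  "path_cost c vs = (\<Sum>i<length vs - 1. c {vs ! i, vs ! Suc i})"

definition cycle_cost :: "('a set \<Rightarrow> real) \<Rightarrow> 'a list \<Rightarrow> real" where
  "cycle_cost c vs = path_cost c vs + c {last vs, hd vs}"

text \<open>
  A problem is given by its feasible vertex sequences and their costs. Cost functions are total
  on vertex sets, but only their values on edges enter the cost of a feasible sequence.
\<close>

record 'a problem =
  feasible :: "'a set \<Rightarrow> 'a set set \<Rightarrow> ('a \<times> 'a) set \<Rightarrow> 'a list \<Rightarrow> bool"
  total_cost :: "('a set \<Rightarrow> real) \<Rightarrow> 'a list \<Rightarrow> real"

definition MinPOHPP :: "'a problem" where
  "MinPOHPP =
     \<lparr> feasible = (\<lambda>V E \<pi> vs. hamiltonian_path V E vs \<and> extending \<pi> vs),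
       total_cost = path_cost \<rparr>"

definition MinPOHCP :: "'a problem" where
  "MinPOHCP =
     \<lparr> feasible = (\<lambda>V E \<pi> vs. hamiltonian_path V E vs \<and> extending \<pi> vs \<and>
                               vs \<noteq> [] \<and> {hd vs, last vs} \<in> E),
       total_cost = cycle_cost \<rparr>"


section \<open>The machine model\<close>

text \<open>
  Programs run on a random access machine with scalar variables and unbounded arrays, once for
  natural numbers (labels, counters, addresses) and once for real numbers (costs). The natural
  number part is a successor machine: its only arithmetic is adding or subtracting one, so that
  after \<open>t\<close> steps all stored numbers are linear in \<open>t\<close> and the input numbers, and charging one
  unit per step hides no more than a logarithmic factor. Real numbers can be added and compared;
  they can neither be rounded nor converted to natural numbers. Expressions in a fixed program
  have constant size, so evaluating one is charged one unit, too.
\<close>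

datatype nexp =
    Const nat
  | NVar string
  | NArr string nexp
  | Succ nexp
  | Pred nexp

datatype rexp =
    RZero
  | RVar string
  | RArr string nexp
  | RAdd rexp rexp

datatype bexp =
    NLess nexp nexp
  | NEq nexp nexp
  | RLess rexp rexp
  | Neg bexp
  | Conj bexp bexp

datatype com =
    Skip
  | NAssign string nexp
  | NStore string nexp nexp
  | RAssign string rexp
  | RStore string nexp rexp
  | Seq com com
  | Cond bexp com com
  | Loop bexp com

record state =
  nvar :: "string \<Rightarrow> nat"
  narr :: "string \<Rightarrow> nat \<Rightarrow> nat"
  rvar :: "string \<Rightarrow> real"
  rarr :: "string \<Rightarrow> nat \<Rightarrow> real"

fun nval :: "nexp \<Rightarrow> state \<Rightarrow> nat" where
  "nval (Const k) s = k"
| "nval (NVar x) s = nvar s x"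
| "nval (NArr a e) s = narr s a (nval e s)"
| "nval (Succ e) s = nval e s + 1"
| "nval (Pred e) s = nval e s - 1"

fun rval :: "rexp \<Rightarrow> state \<Rightarrow> real" where
  "rval RZero s = 0"
| "rval (RVar x) s = rvar s x"
| "rval (RArr a e) s = rarr s a (nval e s)"
| "rval (RAdd e f) s = rval e s + rval f s"

fun bval :: "bexp \<Rightarrow> state \<Rightarrow> bool" where
  "bval (NLess e f) s \<longleftrightarrow> nval e s < nval f s"
| "bval (NEq e f) s \<longleftrightarrow> nval e s = nval f s"
| "bval (RLess e f) s \<longleftrightarrow> rval e s < rval f s"
| "bval (Neg b) s \<longleftrightarrow> \<not> bval b s"
| "bval (Conj a b) s \<longleftrightarrow> bval a s \<and> bval b s"

text \<open>\<open>exec P s t s'\<close>: started in \<open>s\<close>, program \<open>P\<close> halts after exactly \<open>t\<close> steps in \<open>s'\<close>.\<close>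

inductive exec :: "com \<Rightarrow> state \<Rightarrow> nat \<Rightarrow> state \<Rightarrow> bool" where
  Skip: "exec Skip s 1 s"
| NAssign: "exec (NAssign x e) s 1 (s\<lparr>nvar := (nvar s)(x := nval e s)\<rparr>)"
| NStore: "exec (NStore a e f) s 1
             (s\<lparr>narr := (narr s)(a := (narr s a)(nval e s := nval f s))\<rparr>)"
| RAssign: "exec (RAssign x e) s 1 (s\<lparr>rvar := (rvar s)(x := rval e s)\<rparr>)"
| RStore: "exec (RStore a e f) s 1
             (s\<lparr>rarr := (rarr s)(a := (rarr s a)(nval e s := rval f s))\<rparr>)"
| Seq: "exec P s t s' \<Longrightarrow> exec Q s' t' s'' \<Longrightarrow> exec (Seq P Q) s (t + t') s''"
| CondTrue: "bval b s \<Longrightarrow> exec P s t s' \<Longrightarrow> exec (Cond b P Q) s (t + 1) s'"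
| CondFalse: "\<not> bval b s \<Longrightarrow> exec Q s t s' \<Longrightarrow> exec (Cond b P Q) s (t + 1) s'"
| LoopFalse: "\<not> bval b s \<Longrightarrow> exec (Loop b P) s 1 s"
| LoopTrue: "bval b s \<Longrightarrow> exec P s t s' \<Longrightarrow> exec (Loop b P) s' t' s'' \<Longrightarrow>
             exec (Loop b P) s (t + t' + 1) s''"

inductive_cases exec_SkipE: "exec Skip s t s'"
inductive_cases exec_NAssignE: "exec (NAssign x e) s t s'"
inductive_cases exec_NStoreE: "exec (NStore a e f) s t s'"
inductive_cases exec_RAssignE: "exec (RAssign x e) s t s'"
inductive_cases exec_RStoreE: "exec (RStore a e f) s t s'"
inductive_cases exec_SeqE: "exec (Seq P Q) s t s'"
inductive_cases exec_CondE: "exec (Cond b P Q) s t s'"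
inductive_cases exec_LoopE: "exec (Loop b P) s t s'"

lemma exec_deterministic:
  assumes "exec P s t s'" and "exec P s u s''"
  shows "t = u \<and> s' = s''"
  using assms
proof (induction arbitrary: u s'' rule: exec.induct)
  case (Seq P s t s' Q t' s'')
  from Seq.prems show ?case
    by (rule exec_SeqE) (use Seq.IH in metis)
next
  case (CondTrue b s P t s' Q)
  from CondTrue.prems show ?case
    by (rule exec_CondE) (use CondTrue.IH CondTrue.hyps(1) in \<open>metis Suc_eq_plus1\<close>)+
next
  case (CondFalse b s Q t s' P)
  from CondFalse.prems show ?case
    by (rule exec_CondE) (use CondFalse.IH CondFalse.hyps(1) in \<open>metis Suc_eq_plus1\<close>)+
next
  case (LoopFalse b s P)
  from LoopFalse.prems show ?case
    by (rule exec_LoopE) (use LoopFalse.hyps in simp_all)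
next
  case (LoopTrue b s P t s' t' s'')
  from LoopTrue.prems show ?case
    by (rule exec_LoopE) (use LoopTrue.IH LoopTrue.hyps(1) in \<open>metis Suc_eq_plus1\<close>)+
qed (auto elim: exec_SkipE exec_NAssignE exec_NStoreE exec_RAssignE exec_RStoreE)


section \<open>Solving a problem on this machine\<close>

text \<open>
  The vertices of an input graph are \<open>0, \<dots>, n - 1\<close>. The edges are listed without repetition, each
  with an arbitrary choice of first end vertex and with its cost; the pairs of the partial order
  are listed likewise. All other memory is zero.
\<close>

definition input_state ::
    "nat \<Rightarrow> (nat \<times> nat) list \<Rightarrow> (nat \<times> nat) list \<Rightarrow> (nat set \<Rightarrow> real) \<Rightarrow> state" where
  "input_state n es ps c =
     \<lparr> nvar = (\<lambda>_. 0)(''n'' := n, ''m'' := length es, ''p'' := length ps),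
       narr = (\<lambda>_ _. 0)
         (''src'' := (\<lambda>i. if i < length es then fst (es ! i) else 0),
          ''dst'' := (\<lambda>i. if i < length es then snd (es ! i) else 0),
          ''lower'' := (\<lambda>i. if i < length ps then fst (ps ! i) else 0),
          ''upper'' := (\<lambda>i. if i < length ps then snd (ps ! i) else 0)),
       rvar = (\<lambda>_. 0),
       rarr = (\<lambda>_ _. 0)
         (''cost'' := (\<lambda>i. if i < length es then c {fst (es ! i), snd (es ! i)} else 0)) \<rparr>"

definition encodes ::
    "state \<Rightarrow> nat \<Rightarrow> nat set set \<Rightarrow> (nat \<times> nat) set \<Rightarrow> (nat set \<Rightarrow> real) \<Rightarrow> bool" where
  "encodes s n E \<pi> c \<longleftrightarrow>
     (\<exists>es ps. distinct (map (\<lambda>(u, v). {u, v}) es) \<and> set (map (\<lambda>(u, v). {u, v}) es) = E \<and>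
              distinct ps \<and> set ps = \<pi> \<and> s = input_state n es ps c)"

text \<open>
  The variable \<open>found\<close> reports whether there is a feasible sequence; if so, \<open>out\<close> holds one of
  minimum cost.
\<close>

definition correct_output ::
    "nat problem \<Rightarrow> nat \<Rightarrow> nat set set \<Rightarrow> (nat \<times> nat) set \<Rightarrow> (nat set \<Rightarrow> real) \<Rightarrow> state \<Rightarrow> bool"
where
  "correct_output X n E \<pi> c s \<longleftrightarrow>
     (if \<exists>vs. feasible X {..<n} E \<pi> vs
      then nvar s ''found'' = 1 \<and>
           is_arg_min (total_cost X c) (feasible X {..<n} E \<pi>) (map (narr s ''out'') [0..<n])
      else nvar s ''found'' = 0)"

definition solves_in_time :: "com \<Rightarrow> nat problem \<Rightarrow> (nat \<Rightarrow> nat \<Rightarrow> nat) \<Rightarrow> bool" where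
  "solves_in_time P X T \<longleftrightarrow>
     (\<forall>n E \<pi> c s.
        simple_graph {..<n} E \<and> partial_order_on {..<n} \<pi> \<and> encodes s n E \<pi> c \<longrightarrow>
        (\<exists>t s'. exec P s t s' \<and> t \<le> T n (feedback_edge_number E) \<and> correct_output X n E \<pi> c s'))"

definition polynomially_bounded :: "(nat \<Rightarrow> nat) \<Rightarrow> bool" where
  "polynomially_bounded p \<longleftrightarrow> (\<exists>d::nat. (\<lambda>n. real (p n)) \<in> O(\<lambda>n. real n ^ d))"

end

theory Submission
  imports Defs
begin

text \<open>
  Fix a spanning tree; by the acyclicity bound on edges, at most \<open>k\<close> edges lie outside of it. A
  Hamiltonian path is determined by its two ends and by the non-tree edges it uses: every other
  vertex has degree two on the path, so, removing the tree leaf by leaf, the remaining degree of a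
  leaf decides whether its tree edge is used. Hence there are at most \<open>2 ^ k * n\<^sup>2\<close> candidates. Each of
  them is generated and then checked in full, so that the generating procedure need only be correct
  on those inputs that do come from a Hamiltonian path. A cycle is treated as a Hamiltonian path
  with one more edge to check and to pay for.
\<close>

text \<open>The bound on the edges outside of the tree does not depend on which spanning tree is
  taken: it leaves \<open>m - (n - 1)\<close> edges, and a minimum feedback edge set leaves at most
  \<open>n - 1\<close>, so no such set is ever computed. As the machine has no recursion and no
  arithmetic beyond the successor, the choices of non-tree edges are enumerated by a binary counter
  held in an array. To treat inner vertices and ends of a path alike, each end receives one unit of
  degree in advance (two units if both ends coincide), so that every vertex has to reach degree two.
  All loops except the one over the counter run up to an input count; a syntactic time bound covers
  them, and only the exponential loop is analysed by itself. Memory is shared by all candidates, and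
  a choice that belongs to no path leaves arbitrary values in it. Hence termination and time are
  proved unconditionally, whereas statements about the generated sequence are conditional on a
  path.\<close>

section \<open>Running programs\<close>

text \<open>The time bound obtained if every loop makes at most \<open>N\<close> iterations: for a fixed program
  it is a polynomial in \<open>N\<close>.\<close>

fun ptime :: "nat \<Rightarrow> com \<Rightarrow> nat" where
  "ptime N (Seq P Q) = ptime N P + ptime N Q"
| "ptime N (Cond b P Q) = ptime N P + ptime N Q + 1"
| "ptime N (Loop b P) = N * (ptime N P + 1) + 1"
| "ptime N _ = 1"

lemma ptime_pos: "0 < ptime N P"
  by (induction P) auto

fun nvar_writes :: "com \<Rightarrow> string set" where
  "nvar_writes (NAssign x e) = {x}"
| "nvar_writes (Seq P Q) = nvar_writes P \<union> nvar_writes Q"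
| "nvar_writes (Cond b P Q) = nvar_writes P \<union> nvar_writes Q"
| "nvar_writes (Loop b P) = nvar_writes P"
| "nvar_writes _ = {}"

fun narr_writes :: "com \<Rightarrow> string set" where
  "narr_writes (NStore x e f) = {x}"
| "narr_writes (Seq P Q) = narr_writes P \<union> narr_writes Q"
| "narr_writes (Cond b P Q) = narr_writes P \<union> narr_writes Q"
| "narr_writes (Loop b P) = narr_writes P"
| "narr_writes _ = {}"

fun rvar_writes :: "com \<Rightarrow> string set" where
  "rvar_writes (RAssign x e) = {x}"
| "rvar_writes (Seq P Q) = rvar_writes P \<union> rvar_writes Q"
| "rvar_writes (Cond b P Q) = rvar_writes P \<union> rvar_writes Q"
| "rvar_writes (Loop b P) = rvar_writes P"
| "rvar_writes _ = {}"

fun rarr_writes :: "com \<Rightarrow> string set" where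
  "rarr_writes (RStore x e f) = {x}"
| "rarr_writes (Seq P Q) = rarr_writes P \<union> rarr_writes Q"
| "rarr_writes (Cond b P Q) = rarr_writes P \<union> rarr_writes Q"
| "rarr_writes (Loop b P) = rarr_writes P"
| "rarr_writes _ = {}"

text \<open>Write sets are syntactic, and one store counts as a write to the whole array. This is
  coarse, but it lets an invariant mention only what its program changes.\<close>

definition frame :: "com \<Rightarrow> state \<Rightarrow> state \<Rightarrow> bool" where
  "frame P s s' \<longleftrightarrow>
     (\<forall>x. x \<notin> nvar_writes P \<longrightarrow> nvar s' x = nvar s x) \<and>
     (\<forall>x. x \<notin> narr_writes P \<longrightarrow> narr s' x = narr s x) \<and>
     (\<forall>x. x \<notin> rvar_writes P \<longrightarrow> rvar s' x = rvar s x) \<and>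
     (\<forall>x. x \<notin> rarr_writes P \<longrightarrow> rarr s' x = rarr s x)"

lemma frame_nvar: "frame P s s' \<Longrightarrow> x \<notin> nvar_writes P \<Longrightarrow> nvar s' x = nvar s x"
  and frame_narr: "frame P s s' \<Longrightarrow> x \<notin> narr_writes P \<Longrightarrow> narr s' x = narr s x"
  and frame_rvar: "frame P s s' \<Longrightarrow> x \<notin> rvar_writes P \<Longrightarrow> rvar s' x = rvar s x"
  and frame_rarr: "frame P s s' \<Longrightarrow> x \<notin> rarr_writes P \<Longrightarrow> rarr s' x = rarr s x"
  unfolding frame_def by auto

lemmas frame_simps = frame_nvar frame_narr frame_rvar frame_rarr

lemma frame_trans: "frame P s s' \<Longrightarrow> frame P s' s'' \<Longrightarrow> frame P s s''"
  by (simp add: frame_def)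

lemma frame_mono:
  "frame P s s' \<Longrightarrow> nvar_writes P \<subseteq> nvar_writes Q \<Longrightarrow> narr_writes P \<subseteq> narr_writes Q \<Longrightarrow>
   rvar_writes P \<subseteq> rvar_writes Q \<Longrightarrow> rarr_writes P \<subseteq> rarr_writes Q \<Longrightarrow> frame Q s s'"
  unfolding frame_def by blast

lemma exec_frame: "exec P s t s' \<Longrightarrow> frame P s s'"
proof (induction rule: exec.induct)
  case (LoopTrue b s P t s' t' s'')
  have "frame (Loop b P) s s'"
    using LoopTrue.IH(1) by (rule frame_mono) auto
  then show ?case
    using LoopTrue.IH(2) by (rule frame_trans)
qed (auto simp: frame_def)

text \<open>Only halting runs are derivable in \<open>exec\<close>, so this is total correctness
  with a time bound. The postcondition may itself be a \<open>run\<close> statement; programs are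
  chained in this way.\<close>

definition run :: "nat \<Rightarrow> com \<Rightarrow> state \<Rightarrow> (state \<Rightarrow> bool) \<Rightarrow> bool" where
  "run T P s R \<longleftrightarrow> (\<exists>t s'. exec P s t s' \<and> t \<le> T \<and> R s')"

abbreviation prun :: "nat \<Rightarrow> com \<Rightarrow> state \<Rightarrow> (state \<Rightarrow> bool) \<Rightarrow> bool" where
  "prun N P \<equiv> run (ptime N P) P"

lemma run_conseq:
  assumes "run T P s R" and "\<And>s'. frame P s s' \<Longrightarrow> R s' \<Longrightarrow> R' s'" and "T \<le> T'"
  shows "run T' P s R'"
proof -
  obtain t s' where "exec P s t s'" "t \<le> T" "R s'"
    using assms(1) unfolding run_def by blast
  then show ?thesis
    using assms(2)[OF exec_frame] assms(3) unfolding run_def by (intro exI[of _ t] exI[of _ s']) auto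
qed

lemma prun_conseq:
  assumes "prun N P s R" and "\<And>s'. frame P s s' \<Longrightarrow> R s' \<Longrightarrow> R' s'"
  shows "prun N P s R'"
  using run_conseq[OF assms] by simp

lemma run_Seq: "run T P s (\<lambda>s'. run T' Q s' R) \<Longrightarrow> run (T + T') (Seq P Q) s R"
  unfolding run_def by (blast intro: exec.Seq add_mono)

lemma prun_Seq: "prun N P s (\<lambda>s'. prun N Q s' R) \<Longrightarrow> prun N (Seq P Q) s R"
  by (simp add: run_Seq)

lemma run_Cond:
  assumes "bval b s \<Longrightarrow> run T P s R" and "\<not> bval b s \<Longrightarrow> run T Q s R"
  shows "run (T + 1) (Cond b P Q) s R"
proof (cases "bval b s")
  case True
  with assms(1) obtain t s' where "exec P s t s'" "t \<le> T" "R s'"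
    unfolding run_def by blast
  with True show ?thesis
    unfolding run_def by (intro exI[of _ "t + 1"] exI[of _ s'])
      (auto intro: exec.CondTrue[unfolded Suc_eq_plus1[symmetric]])
next
  case False
  with assms(2) obtain t s' where "exec Q s t s'" "t \<le> T" "R s'"
    unfolding run_def by blast
  with False show ?thesis
    unfolding run_def by (intro exI[of _ "t + 1"] exI[of _ s'])
      (auto intro: exec.CondFalse[unfolded Suc_eq_plus1[symmetric]])
qed

lemma prun_Cond:
  assumes "bval b s \<Longrightarrow> prun N P s R" and "\<not> bval b s \<Longrightarrow> prun N Q s R"
  shows "prun N (Cond b P Q) s R"
proof -
  have "run (ptime N P + ptime N Q + 1) (Cond b P Q) s R"
    by (rule run_Cond; drule assms; erule run_conseq; simp)
  then show ?thesis by simp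
qed

fun loop_free :: "com \<Rightarrow> bool" where
  "loop_free (Seq P Q) \<longleftrightarrow> loop_free P \<and> loop_free Q"
| "loop_free (Cond b P Q) \<longleftrightarrow> loop_free P \<and> loop_free Q"
| "loop_free (Loop b P) \<longleftrightarrow> False"
| "loop_free _ \<longleftrightarrow> True"

text \<open>The value on loops is irrelevant.\<close>

fun step :: "com \<Rightarrow> state \<Rightarrow> state" where
  "step Skip s = s"
| "step (NAssign x e) s = s\<lparr>nvar := (nvar s)(x := nval e s)\<rparr>"
| "step (NStore a e f) s = s\<lparr>narr := (narr s)(a := (narr s a)(nval e s := nval f s))\<rparr>"
| "step (RAssign x e) s = s\<lparr>rvar := (rvar s)(x := rval e s)\<rparr>"
| "step (RStore a e f) s = s\<lparr>rarr := (rarr s)(a := (rarr s a)(nval e s := rval f s))\<rparr>"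
| "step (Seq P Q) s = step Q (step P s)"
| "step (Cond b P Q) s = (if bval b s then step P s else step Q s)"
| "step (Loop b P) s = s"

text \<open>Straight-line code and branching are thereby verified by rewriting with
  \<open>step\<close>.\<close>

lemma loop_free_exec:
  "loop_free P \<Longrightarrow> \<exists>t. exec P s t (step P s) \<and> t \<le> ptime N P"
proof (induction P arbitrary: s)
  case (Seq P Q)
  obtain t u where "exec P s t (step P s)" "t \<le> ptime N P"
    "exec Q (step P s) u (step Q (step P s))" "u \<le> ptime N Q"
    using Seq by force
  then show ?case
    by (intro exI[of _ "t + u"]) (auto intro: exec.Seq)
next
  case (Cond b P Q)
  show ?case
  proof (cases "bval b s")
    case True
    with Cond obtain t where "exec P s t (step P s)" "t \<le> ptime N P" by auto
    with True show ?thesis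
      by (intro exI[of _ "t + 1"]) (auto intro: exec.CondTrue[unfolded Suc_eq_plus1[symmetric]])
  next
    case False
    with Cond obtain t where "exec Q s t (step Q s)" "t \<le> ptime N Q" by auto
    with False show ?thesis
      by (intro exI[of _ "t + 1"]) (auto intro: exec.CondFalse[unfolded Suc_eq_plus1[symmetric]])
  qed
qed (auto intro: exec.intros)

lemma prun_step: "loop_free P \<Longrightarrow> R (step P s) \<Longrightarrow> prun N P s R"
  unfolding run_def using loop_free_exec by blast

lemma run_step_Seq:
  "loop_free P \<Longrightarrow> run T Q (step P s) R \<Longrightarrow> run (ptime N P + T) (Seq P Q) s R"
  by (rule run_Seq, rule prun_step)

lemma prun_step_Seq: "loop_free P \<Longrightarrow> prun N Q (step P s) R \<Longrightarrow> prun N (Seq P Q) s R"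
  by (rule prun_Seq, rule prun_step)

text \<open>This holds because programs are deterministic.\<close>

lemma run_all: "(\<And>x. run T P s (R x)) \<Longrightarrow> run T P s (\<lambda>s'. \<forall>x. R x s')"
  unfolding run_def using exec_deterministic by metis

text \<open>The index of the invariant counts completed rounds. While the guard holds it must stay
  below \<open>M\<close>, which gives termination and the time bound at once. \<open>M\<close> is
  separate from the bound \<open>N\<close> of \<open>ptime\<close> because the outermost loop runs
  exponentially often.\<close>

lemma run_Loop:
  assumes body: "\<And>i s. I i s \<Longrightarrow> bval b s \<Longrightarrow> i < M \<and> run T P s (I (Suc i))"
    and init: "I 0 s"
    and exit: "\<And>i s. I i s \<Longrightarrow> \<not> bval b s \<Longrightarrow> R s"
  shows "run (M * (T + 1) + 1) (Loop b P) s R"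
proof -
  \<comment> \<open>Here \<open>d\<close> is the number of rounds still available.\<close>
  have "i + d = M \<Longrightarrow> I i s \<Longrightarrow> run (d * (T + 1) + 1) (Loop b P) s R" for i d s
  proof (induction d arbitrary: i s)
    case 0
    then have "\<not> bval b s" using body[of i s] by auto
    then show ?case
      using exit[OF 0(2)] exec.LoopFalse unfolding run_def by fastforce
  next
    case (Suc d)
    show ?case
    proof (cases "bval b s")
      case False
      then show ?thesis
        using exit[OF Suc.prems(2)] exec.LoopFalse unfolding run_def by fastforce
    next
      case True
      obtain t s' where s': "exec P s t s'" "t \<le> T" "I (Suc i) s'"
        using body[OF Suc.prems(2) True] unfolding run_def by auto
      obtain t' s'' where s'': "exec (Loop b P) s' t' s''" "t' \<le> d * (T + 1) + 1" "R s''"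
        using Suc.IH[of "Suc i" s'] Suc.prems(1) s'(3) unfolding run_def by auto
      have "exec (Loop b P) s (t + t' + 1) s''"
        using True s'(1) s''(1) by (rule exec.LoopTrue)
      moreover have "t + t' + 1 \<le> Suc d * (T + 1) + 1"
        using s'(2) s''(2) by simp
      ultimately show ?thesis
        using s''(3) unfolding run_def by blast
    qed
  qed
  from this[of 0 M] show ?thesis using init by simp
qed

definition For :: "string \<Rightarrow> string \<Rightarrow> com \<Rightarrow> com" where
  "For x y P = Seq (NAssign x (Const 0))
     (Loop (NLess (NVar x) (NVar y)) (Seq P (NAssign x (Succ (NVar x)))))"

lemma writes_For [simp]:
  "nvar_writes (For x y P) = insert x (nvar_writes P)"
  "narr_writes (For x y P) = narr_writes P"
  "rvar_writes (For x y P) = rvar_writes P"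
  "rarr_writes (For x y P) = rarr_writes P"
  by (auto simp: For_def)

text \<open>The body is proved under a frame relative to the state before the loop, so unchanged
  memory need not enter \<open>I\<close>. The premise \<open>indep\<close> is due to the assignments
  to the counter, which lie outside of the body. Where the rule is used with
  \<open>goal_cases\<close>, goals 5 to 8 are \<open>init\<close>, \<open>indep\<close>,
  \<open>body\<close> and \<open>exit\<close>.\<close>

lemma prun_For:
  assumes fresh: "x \<notin> nvar_writes P" "y \<notin> nvar_writes P" "x \<noteq> y"
    and bound: "nvar s y \<le> N"
    and init: "I 0 s"
    and indep: "\<And>i k s. I i s \<Longrightarrow> I i (s\<lparr>nvar := (nvar s)(x := k)\<rparr>)"
    and body: "\<And>i s'. i < nvar s y \<Longrightarrow> nvar s' x = i \<Longrightarrow> frame (For x y P) s s' \<Longrightarrow> I i s' \<Longrightarrow>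
        prun N P s' (I (Suc i))"
    and exit: "\<And>s'. frame (For x y P) s s' \<Longrightarrow> I (nvar s y) s' \<Longrightarrow> R s'"
  shows "prun N (For x y P) s R"
proof -
  let ?s = "s\<lparr>nvar := (nvar s)(x := 0)\<rparr>"
  define J where
    "J i s' \<longleftrightarrow> i \<le> nvar s y \<and> nvar s' x = i \<and> frame (For x y P) s s' \<and> I i s'" for i s'
  have y: "nvar s' y = nvar s y" if "frame (For x y P) s s'" for s'
    using that fresh by (simp add: frame_nvar)
  have step: "run (ptime N P + 1) (Seq P (NAssign x (Succ (NVar x)))) s' (J (Suc i))"
    if J: "J i s'" and b: "bval (NLess (NVar x) (NVar y)) s'" for i s'
  proof -
    have i: "i < nvar s y" using J b y by (auto simp: J_def)
    have "prun N P s' (I (Suc i))"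
      by (rule body) (use J i in \<open>auto simp: J_def\<close>)
    then have "prun N P s' (\<lambda>s''. run 1 (NAssign x (Succ (NVar x))) s'' (J (Suc i)))"
    proof (rule prun_conseq)
      fix s'' assume fr: "frame P s' s''" and I: "I (Suc i) s''"
      have x: "nvar s'' x = i" using fr fresh J by (simp add: J_def frame_nvar)
      have "frame (For x y P) s' s''"
        using fr by (rule frame_mono) auto
      then have "frame (For x y P) s s''"
        using J frame_trans unfolding J_def by blast
      then have "frame (For x y P) s (s''\<lparr>nvar := (nvar s'')(x := Suc i)\<rparr>)"
        by (simp add: frame_def)
      then have "J (Suc i) (s''\<lparr>nvar := (nvar s'')(x := Suc i)\<rparr>)"
        using i I indep by (simp add: J_def)
      then show "run 1 (NAssign x (Succ (NVar x))) s'' (J (Suc i))"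
        using exec.NAssign[of x "Succ (NVar x)" s''] x unfolding run_def by fastforce
    qed
    then show ?thesis by (rule run_Seq)
  qed
  have "frame (For x y P) s ?s" by (simp add: frame_def)
  then have J0: "J 0 ?s" using init indep by (simp add: J_def)
  have loop: "run (N * (ptime N P + 1 + 1) + 1)
      (Loop (NLess (NVar x) (NVar y)) (Seq P (NAssign x (Succ (NVar x))))) ?s R"
  proof (rule run_Loop[where I = J])
    show "i < N \<and> run (ptime N P + 1) (Seq P (NAssign x (Succ (NVar x)))) s' (J (Suc i))"
      if "J i s'" "bval (NLess (NVar x) (NVar y)) s'" for i s'
    proof
      show "i < N" using that y bound by (auto simp: J_def)
    qed (rule step[OF that])
    show "R s'" if J: "J i s'" and b: "\<not> bval (NLess (NVar x) (NVar y)) s'" for i s'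
    proof -
      have "i = nvar s y" using J b y by (auto simp: J_def)
      then show ?thesis using J exit by (auto simp: J_def)
    qed
  qed (fact J0)
  have "run 1 (NAssign x (Const 0)) s (\<lambda>s'. s' = ?s)"
    using exec.NAssign[of x "Const 0" s] by (auto simp: run_def)
  then have "run 1 (NAssign x (Const 0)) s (\<lambda>s'. run (N * (ptime N P + 1 + 1) + 1)
      (Loop (NLess (NVar x) (NVar y)) (Seq P (NAssign x (Succ (NVar x))))) s' R)"
    by (rule run_conseq) (use loop in auto)
  from run_Seq[OF this] show ?thesis
    by (simp add: For_def)
qed

section \<open>Closure properties of polynomial bounds\<close>

lemma polynomially_bounded_const: "polynomially_bounded (\<lambda>_. c)"
  unfolding polynomially_bounded_def by (intro exI[of _ 0]) auto

lemma polynomially_bounded_id: "polynomially_bounded (\<lambda>n. n)"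
  unfolding polynomially_bounded_def by (intro exI[of _ 1]) auto

lemma polynomially_bounded_mult:
  assumes "polynomially_bounded p" "polynomially_bounded q"
  shows "polynomially_bounded (\<lambda>n. p n * q n)"
proof -
  obtain d e where "(\<lambda>n. real (p n)) \<in> O(\<lambda>n. real n ^ d)" "(\<lambda>n. real (q n)) \<in> O(\<lambda>n. real n ^ e)"
    using assms unfolding polynomially_bounded_def by blast
  then have "(\<lambda>n. real (p n) * real (q n)) \<in> O(\<lambda>n. real n ^ d * real n ^ e)"
    by (rule landau_o.big.mult)
  then show ?thesis
    unfolding polynomially_bounded_def by (auto simp: power_add intro!: exI[of _ "d + e"])
qed

lemma polynomially_bounded_add:
  assumes "polynomially_bounded p" "polynomially_bounded q"
  shows "polynomially_bounded (\<lambda>n. p n + q n)"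
proof -
  obtain d e where d: "(\<lambda>n. real (p n)) \<in> O(\<lambda>n. real n ^ d)"
    and e: "(\<lambda>n. real (q n)) \<in> O(\<lambda>n. real n ^ e)"
    using assms unfolding polynomially_bounded_def by blast
  have mono: "(\<lambda>n. real n ^ a) \<in> O(\<lambda>n. real n ^ (a + b))" for a b
  proof (rule bigoI[where c = 1])
    show "\<forall>\<^sub>F n in at_top. norm (real n ^ a) \<le> 1 * norm (real n ^ (a + b))"
      using eventually_ge_at_top[of "1::nat"]
      by eventually_elim (simp add: power_increasing)
  qed
  have "(\<lambda>n. real (p n) + real (q n)) \<in> O(\<lambda>n. real n ^ (d + e))"
    using landau_o.big.trans[OF d mono[of d e]] landau_o.big.trans[OF e mono[of e d]]
    by (simp add: add.commute sum_in_bigo)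
  then show ?thesis
    unfolding polynomially_bounded_def by auto
qed

text \<open>For a fixed program, \<open>ptime\<close> is built from constants and its bound by sums
  and products only; to this end a conditional is charged for both branches instead of their
  maximum.\<close>

lemma polynomially_bounded_ptime:
  "polynomially_bounded f \<Longrightarrow> polynomially_bounded (\<lambda>n. ptime (f n) P)"
  by (induction P)
     (simp_all add: polynomially_bounded_add polynomially_bounded_mult polynomially_bounded_const
       del: One_nat_def mult_Suc_right add_Suc_right)

section \<open>Graphs\<close>

lemma acyclic_graph_mono: "acyclic_graph E \<Longrightarrow> F \<subseteq> E \<Longrightarrow> acyclic_graph F"
  unfolding acyclic_graph_def graph_cycle_def by blast

lemma simple_graph_edgeE:
  assumes "simple_graph V E" "e \<in> E" "v \<in> e"
  obtains u where "e = {v, u}" "u \<noteq> v" "u \<in> V" "v \<in> V"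
proof -
  obtain a b where ab: "a \<in> V" "b \<in> V" "a \<noteq> b" "e = {a, b}"
    using assms(1,2) unfolding simple_graph_def by blast
  show ?thesis
  proof (cases "v = a")
    case True
    with ab show ?thesis using that[of b] by auto
  next
    case False
    with ab assms(3) show ?thesis using that[of a] by auto
  qed
qed

lemma simple_graph_finite: "simple_graph V E \<Longrightarrow> finite E"
proof -
  assume g: "simple_graph V E"
  then have "E \<subseteq> Pow V" unfolding simple_graph_def by auto
  moreover have "finite (Pow V)" using g by (simp add: simple_graph_def)
  ultimately show "finite E" by (rule finite_subset)
qed

text \<open>Otherwise, an end vertex of a longest path has a second neighbor on that path, and this
  closes a cycle.\<close>

lemma acyclic_graph_leaf:
  assumes g: "simple_graph V E" and ac: "acyclic_graph E" and ne: "V \<noteq> {}"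
  shows "\<exists>v\<in>V. card {e \<in> E. v \<in> e} \<le> 1"
proof (rule ccontr)
  assume "\<not> (\<exists>v\<in>V. card {e \<in> E. v \<in> e} \<le> 1)"
  then have deg: "1 < card {e \<in> E. v \<in> e}" if "v \<in> V" for v
    using that by (simp add: not_le)
  have finV: "finite V" using g by (simp add: simple_graph_def)
  define P where "P vs \<longleftrightarrow> vs \<noteq> [] \<and> distinct vs \<and> set vs \<subseteq> V \<and>
    (\<forall>i. Suc i < length vs \<longrightarrow> {vs ! i, vs ! Suc i} \<in> E)" for vs
  obtain v where "v \<in> V" using ne by blast
  then have "P [v]" by (simp add: P_def)
  moreover have "length vs < Suc (card V)" if "P vs" for vs
    using that finV distinct_card[of vs] card_mono[of V "set vs"] unfolding P_def by simp
  \<comment> \<open>Distinct lists over \<open>V\<close> have bounded length, so a longest path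
    exists.\<close>
  ultimately obtain vs where vs: "P vs" and max: "\<And>ws. P ws \<Longrightarrow> length ws \<le> length vs"
    using ex_has_greatest_nat[of P "[v]" length "Suc (card V)"] by (metis less_imp_le)
  define x where "x = hd vs"
  have x0: "x = vs ! 0" using vs by (simp add: x_def P_def hd_conv_nth)
  have xV: "x \<in> V" using vs by (auto simp: x_def P_def)
  have fin: "finite {e \<in> E. x \<in> e}" using simple_graph_finite[OF g] by simp
  obtain e f where ef: "e \<in> E" "f \<in> E" "x \<in> e" "x \<in> f" "e \<noteq> f"
    using deg[OF xV] card_le_Suc0_iff_eq[OF fin] by auto
  obtain a b where ab: "e = {x, a}" "f = {x, b}" "a \<noteq> x" "b \<noteq> x" "a \<in> V" "b \<in> V"
    using simple_graph_edgeE[OF g ef(1,3)] simple_graph_edgeE[OF g ef(2,4)] by metis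
  \<comment> \<open>Of two distinct neighbors, at least one is not the second vertex of the path. If
    the path has a single vertex, \<open>vs ! 1\<close> is an unspecified value, and the choice is
    still possible.\<close>
  obtain y where y: "{x, y} \<in> E" "y \<noteq> x" "y \<in> V" "y \<noteq> vs ! 1"
    using ab ef by metis
  have "y \<in> set vs"
  proof (rule ccontr)
    assume "y \<notin> set vs"
    then have "P (y # vs)"
      using vs y x0 unfolding P_def by (auto simp: nth_Cons insert_commute split: nat.split)
    from max[OF this] show False by simp
  qed
  then obtain j where j: "j < length vs" "vs ! j = y" by (auto simp: in_set_conv_nth)
  have "j \<noteq> 0" using j(2) y(2) x0 by metis
  moreover have "j \<noteq> 1" using j(2) y(4) by metis
  ultimately have j2: "2 \<le> j" by simp
  \<comment> \<open>The prefix that ends in \<open>y\<close> has at least three vertices, and the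
    edge between \<open>y\<close> and \<open>x\<close> closes it.\<close>
  let ?c = "take (Suc j) vs"
  have len: "length ?c = Suc j" using j by simp
  have "last ?c = y" using j by (simp add: take_Suc_conv_app_nth)
  moreover have "hd ?c = x" using x_def vs by (simp add: P_def)
  ultimately have "graph_cycle E ?c"
    using vs y j j2 len unfolding graph_cycle_def P_def by (auto simp: insert_commute)
  then show False using ac by (auto simp: acyclic_graph_def)
qed

text \<open>Deleting a vertex of degree at most one loses at most one edge and keeps the graph
  acyclic; a single vertex has no edge.\<close>

lemma acyclic_graph_card:
  "simple_graph V E \<Longrightarrow> acyclic_graph E \<Longrightarrow> V \<noteq> {} \<Longrightarrow> card E < card V"
proof (induction "card V" arbitrary: V E rule: less_induct)
  case less
  have finV: "finite V" using less.prems by (simp add: simple_graph_def)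
  have finE: "finite E" using less.prems(1) by (rule simple_graph_finite)
  obtain v where v: "v \<in> V" "card {e \<in> E. v \<in> e} \<le> 1"
    using acyclic_graph_leaf[OF less.prems] by blast
  let ?F = "{e \<in> E. v \<notin> e}"
  have g: "simple_graph (V - {v}) ?F"
    using less.prems(1) unfolding simple_graph_def by fastforce
  have split: "card E = card ?F + card {e \<in> E. v \<in> e}"
  proof -
    have "E = ?F \<union> {e \<in> E. v \<in> e}" by blast
    then have "card E = card (?F \<union> {e \<in> E. v \<in> e})" by (rule arg_cong)
    also have "\<dots> = card ?F + card {e \<in> E. v \<in> e}"
      using finE by (intro card_Un_disjoint) auto
    finally show ?thesis .
  qed
  show ?case
  proof (cases "V - {v} = {}")
    case True
    then have "u = w" if "u \<in> V" "w \<in> V" for u w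
      using that by blast
    then have "E = {}"
      using less.prems(1) unfolding simple_graph_def by blast
    then show ?thesis using v finV by (auto simp: card_gt_0_iff)
  next
    case False
    have "acyclic_graph ?F" using less.prems(2) by (rule acyclic_graph_mono) auto
    with less.hyps[OF _ g] False have "card ?F < card (V - {v})"
      using card_Diff1_less[OF finV v(1)] by blast
    then show ?thesis using split v finV by simp
  qed
qed

text \<open>A minimum feedback edge set leaves a forest, which has fewer edges than vertices.
  Nothing else about the feedback edge number enters the time bound.\<close>

lemma card_le_feedback_edge_number:
  assumes g: "simple_graph V E" and ne: "V \<noteq> {}"
  shows "card E < feedback_edge_number E + card V"
proof -
  \<comment> \<open>Deleting all edges shows that the minimum is taken over a nonempty set.\<close>
  have "acyclic_graph (E - E)"
    unfolding acyclic_graph_def graph_cycle_def by auto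
  then have "\<exists>k. \<exists>F\<subseteq>E. card F = k \<and> acyclic_graph (E - F)" by blast
  then have "\<exists>F\<subseteq>E. card F = feedback_edge_number E \<and> acyclic_graph (E - F)"
    unfolding feedback_edge_number_def by (rule LeastI_ex)
  then obtain F where F: "F \<subseteq> E" "card F = feedback_edge_number E" "acyclic_graph (E - F)"
    by blast
  have "simple_graph V (E - F)" using g by (auto simp: simple_graph_def)
  then have "card (E - F) < card V"
    using F(3) ne by (rule acyclic_graph_card)
  moreover have "card E = card F + card (E - F)"
    using F(1) simple_graph_finite[OF g] by (metis card_Diff_subset card_mono finite_subset le_add_diff_inverse)
  ultimately show ?thesis using F(2) by simp
qed

section \<open>Degrees on a path, and cuts crossed by it\<close>

definition path_edges :: "'a list \<Rightarrow> 'a set set" where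
  "path_edges vs = {{vs ! i, vs ! Suc i} | i. Suc i < length vs}"

text \<open>An end of the path lacks one of the two neighbors, and an indicator makes up for it; on
  a path with a single vertex both indicators apply.\<close>

lemma path_degree:
  assumes d: "distinct vs" and a: "a < length vs"
  shows "of_bool (a = 0) + of_bool (Suc a = length vs) + card {e \<in> path_edges vs. vs ! a \<in> e} = (2::nat)"
proof -
  let ?A = "if 0 < a then {{vs ! (a - 1), vs ! a}} else {}"
  let ?B = "if Suc a < length vs then {{vs ! a, vs ! Suc a}} else {}"
  have "{e \<in> path_edges vs. vs ! a \<in> e} = ?A \<union> ?B"
  proof
    show "{e \<in> path_edges vs. vs ! a \<in> e} \<subseteq> ?A \<union> ?B"
    proof
      fix e assume "e \<in> {e \<in> path_edges vs. vs ! a \<in> e}"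
      then obtain i where i: "e = {vs ! i, vs ! Suc i}" "Suc i < length vs" "vs ! a \<in> e"
        by (auto simp: path_edges_def)
      then have "a = i \<or> a = Suc i"
        using d a by (auto simp: nth_eq_iff_index_eq)
      then show "e \<in> ?A \<union> ?B" using i by auto
    qed
    show "?A \<union> ?B \<subseteq> {e \<in> path_edges vs. vs ! a \<in> e}"
    proof -
      have "{vs ! (a - 1), vs ! a} \<in> path_edges vs" if "0 < a"
        using that a unfolding path_edges_def by (auto intro!: exI[of _ "a - 1"])
      moreover have "{vs ! a, vs ! Suc a} \<in> path_edges vs" if "Suc a < length vs"
        using that unfolding path_edges_def by auto
      ultimately show ?thesis by (simp split: if_splits)
    qed
  qed
  moreover have "?A \<inter> ?B = {}"
    using d by (auto simp: doubleton_eq_iff nth_eq_iff_index_eq split: if_splits)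
  moreover have "card ?A = of_bool (0 < a)" "card ?B = of_bool (Suc a < length vs)" by auto
  ultimately have "card {e \<in> path_edges vs. vs ! a \<in> e} = of_bool (0 < a) + of_bool (Suc a < length vs)"
    by (simp add: card_Un_disjoint)
  then show ?thesis using a by auto
qed

text \<open>Otherwise membership in \<open>W\<close> would be constant along the path, which meets
  both sides. It is used to show that growing a tree cannot stall while a vertex is
  unvisited.\<close>

lemma connected_step:
  assumes "hamiltonian_path V E vs" "a \<in> W" "W \<subset> V" "a \<in> V"
  shows "\<exists>e\<in>E. \<exists>u v. e = {u, v} \<and> u \<in> W \<and> v \<in> V - W"
proof (rule ccontr)
  assume neg: "\<not> ?thesis"
  have adj: "vs ! i \<in> W \<longleftrightarrow> vs ! Suc i \<in> W" if "Suc i < length vs" for i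
  proof -
    have "{vs ! i, vs ! Suc i} \<in> E" "vs ! i \<in> V" "vs ! Suc i \<in> V"
      using assms(1) that nth_mem[of i vs] nth_mem[of "Suc i" vs] by (auto simp: hamiltonian_path_def)
    then show ?thesis using neg by (metis DiffI insert_commute)
  qed
  have "vs ! i \<in> W \<longleftrightarrow> vs ! 0 \<in> W" if "i < length vs" for i
    using that by (induction i) (use adj in auto)
  moreover obtain i where "i < length vs" "vs ! i = a"
    using assms(1,4) by (metis hamiltonian_path_def in_set_conv_nth)
  moreover obtain b where "b \<in> V" "b \<notin> W" using assms(3) by blast
  moreover obtain j where "j < length vs" "vs ! j = b"
    using assms(1) \<open>b \<in> V\<close> by (metis hamiltonian_path_def in_set_conv_nth)
  ultimately show False using assms(2) by blast
qed

section \<open>Binary counters\<close>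

text \<open>A counter has a binary digit at every position at which \<open>skip\<close> is false.\<close>

primrec digits :: "(nat \<Rightarrow> bool) \<Rightarrow> nat \<Rightarrow> nat" where
  "digits skip 0 = 0"
| "digits skip (Suc i) = (if skip i then digits skip i else Suc (digits skip i))"

primrec counter_val :: "(nat \<Rightarrow> bool) \<Rightarrow> (nat \<Rightarrow> nat) \<Rightarrow> nat \<Rightarrow> nat" where
  "counter_val skip f 0 = 0"
| "counter_val skip f (Suc i) =
     (if skip i then counter_val skip f i else counter_val skip f i + f i * 2 ^ digits skip i)"

text \<open>With the tree edges as skipped positions, the number of digits becomes the number of
  edges outside of the tree.\<close>

lemma digits_card: "digits skip m + card {i. i < m \<and> skip i} = m"
proof (induction m)
  case (Suc m)
  have "{i. i < Suc m \<and> skip i} = (if skip m then insert m {i. i < m \<and> skip i} else {i. i < m \<and> skip i})"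
    by (auto simp: less_Suc_eq)
  with Suc show ?case by simp
qed simp

lemma counter_val_cong:
  "(\<And>i. i < m \<Longrightarrow> \<not> skip i \<Longrightarrow> f i = g i) \<Longrightarrow> counter_val skip f m = counter_val skip g m"
  by (induction m) auto

lemma counter_val_less:
  "\<forall>i<m. \<not> skip i \<longrightarrow> f i \<le> 1 \<Longrightarrow> counter_val skip f m < 2 ^ digits skip m"
proof (induction m)
  case (Suc m)
  then have IH: "counter_val skip f m < 2 ^ digits skip m" by simp
  show ?case
  proof (cases "skip m")
    case False
    then have "f m \<le> 1" using Suc.prems by simp
    then have "f m = 0 \<or> f m = 1" by auto
    with IH False show ?thesis by auto
  qed (use IH in simp)
qed simp

text \<open>Uniqueness of binary representations, lowest digit first. It identifies a choice of
  edges by the value of the counter.\<close>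

lemma counter_val_inject:
  "\<forall>i<m. \<not> skip i \<longrightarrow> f i \<le> 1 \<Longrightarrow> \<forall>i<m. \<not> skip i \<longrightarrow> g i \<le> 1 \<Longrightarrow>
   counter_val skip f m = counter_val skip g m \<Longrightarrow> i < m \<Longrightarrow> \<not> skip i \<Longrightarrow> f i = g i"
proof (induction m arbitrary: i)
  case (Suc m)
  have less: "counter_val skip f m < 2 ^ digits skip m" "counter_val skip g m < 2 ^ digits skip m"
    using Suc.prems by (auto intro!: counter_val_less)
  \<comment> \<open>The digits below position \<open>m\<close> contribute less than the weight of
    digit \<open>m\<close>, so equal values have equal top digits and equal remainders.\<close>
  have *: "counter_val skip f m = counter_val skip g m \<and> (\<not> skip m \<longrightarrow> f m = g m)"
  proof (cases "skip m")
    case True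
    then show ?thesis using Suc.prems by simp
  next
    case False
    then have "f m \<le> 1" "g m \<le> 1" using Suc.prems by auto
    then have "f m = 0 \<or> f m = 1" "g m = 0 \<or> g m = 1" by auto
    then show ?thesis using False less Suc.prems(3) by auto
  qed
  show ?case
  proof (cases "i = m")
    case True
    then show ?thesis using * Suc.prems by simp
  next
    case False
    then show ?thesis using Suc.IH[of i] Suc.prems * by simp
  qed
qed simp

section \<open>The spanning tree\<close>

abbreviation "var_i \<equiv> NVar ''i''"
abbreviation "src_i \<equiv> NArr ''src'' (NVar ''i'')"
abbreviation "dst_i \<equiv> NArr ''dst'' (NVar ''i'')"

definition add_edge :: "nexp \<Rightarrow> com" where
  "add_edge v = Seq (NAssign ''slot'' (Pred (NVar ''slot'')))
     (Seq (NStore ''te'' (NVar ''slot'') var_i)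
     (Seq (NStore ''ch'' (NVar ''slot'') v)
     (Seq (NStore ''tree'' var_i (Const 1))
          (NStore ''vis'' v (Const 1)))))"

definition grow_step :: com where
  "grow_step =
     Cond (Conj (NEq (NArr ''vis'' src_i) (Const 1)) (NEq (NArr ''vis'' dst_i) (Const 0)))
       (add_edge dst_i)
       (Cond (Conj (NEq (NArr ''vis'' dst_i) (Const 1)) (NEq (NArr ''vis'' src_i) (Const 0)))
         (add_edge src_i)
         Skip)"

text \<open>Tree edges are stored from the last slot \<open>n - 2\<close> downwards, each together with its newly
  visited end vertex. Read upwards, the tree is dismantled leaf by leaf.\<close>

definition grow_tree :: com where
  "grow_tree = Seq (NAssign ''slot'' (Pred (NVar ''n'')))
     (Seq (NStore ''vis'' (Const 0) (Const 1))
          (For ''a'' ''n'' (For ''i'' ''m'' grow_step)))"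

text \<open>The single bound \<open>N\<close> dominates all input counts, so that
  \<open>ptime N\<close> applies to every \<open>For\<close> loop. Vertex 0 is the root of the tree,
  hence \<open>n_pos\<close>.\<close>

locale poh_instance =
  fixes N n :: nat and es ps :: "(nat \<times> nat) list" and E :: "nat set set"
    and \<pi> :: "(nat \<times> nat) set" and c :: "nat set \<Rightarrow> real" and cyc :: bool
  assumes graph: "simple_graph {..<n} E"
    and order: "partial_order_on {..<n} \<pi>"
    and distinct_es: "distinct (map (\<lambda>(u, v). {u, v}) es)"
    and set_es: "set (map (\<lambda>(u, v). {u, v}) es) = E"
    and set_ps: "set ps = \<pi>"
    and n_pos: "0 < n"
    and bounds: "n \<le> N" "length es \<le> N" "length ps \<le> N"
begin

definition m :: nat where "m = length es"

definition src :: "nat \<Rightarrow> nat" where "src i = fst (es ! i)"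

definition dst :: "nat \<Rightarrow> nat" where "dst i = snd (es ! i)"

definition ed :: "nat \<Rightarrow> nat set" where "ed i = {src i, dst i}"

lemma ed_map: "i < m \<Longrightarrow> ed i = map (\<lambda>(u, v). {u, v}) es ! i"
  by (simp add: m_def ed_def src_def dst_def case_prod_beta)

lemma E_eq: "E = ed ` {..<m}"
proof -
  have "E = (!) (map (\<lambda>(u, v). {u, v}) es) ` {..<m}"
    unfolding set_es[symmetric] m_def by (metis nth_image length_map lessThan_atLeast0 order_refl take_all)
  then show ?thesis using ed_map by simp
qed

lemma inj_ed: "inj_on ed {..<m}"
  using distinct_es ed_map by (auto simp: inj_on_def m_def distinct_conv_nth)

lemma ed_eq: "i < m \<Longrightarrow> j < m \<Longrightarrow> ed i = ed j \<longleftrightarrow> i = j"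
  using inj_ed by (auto simp: inj_on_def)

lemma card_E: "card E = m"
  unfolding E_eq using inj_ed by (simp add: card_image)

lemma ends:
  assumes "i < m"
  shows "src i < n" "dst i < n" "src i \<noteq> dst i"
proof -
  have "ed i \<in> E" using assms E_eq by blast
  then obtain u v where "u < n" "v < n" "u \<noteq> v" "{src i, dst i} = {u, v}"
    using graph by (auto simp: simple_graph_def ed_def)
  then show "src i < n" "dst i < n" "src i \<noteq> dst i" by (auto simp: doubleton_eq_iff)
qed

definition inp :: "state \<Rightarrow> bool" where
  "inp s \<longleftrightarrow> nvar s ''n'' = n \<and> nvar s ''m'' = m \<and> nvar s ''p'' = length ps \<and>
     (\<forall>i<m. narr s ''src'' i = src i \<and> narr s ''dst'' i = dst i \<and> rarr s ''cost'' i = c (ed i)) \<and>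
     (\<forall>q<length ps. narr s ''lower'' q = fst (ps ! q) \<and> narr s ''upper'' q = snd (ps ! q))"

lemma inp_frame:
  assumes "inp s" "frame P s s'" "nvar_writes P \<inter> {''n'', ''m'', ''p''} = {}"
    "narr_writes P \<inter> {''src'', ''dst'', ''lower'', ''upper''} = {}" "''cost'' \<notin> rarr_writes P"
  shows "inp s'"
  using assms by (simp add: inp_def frame_def)

text \<open>The sum in the third clause makes \<open>slot\<close> the number of unvisited vertices,
  so \<open>slot = 0\<close> means that the tree spans. The clause on \<open>j < k\<close> is the
  leaf order: once the edges in slots below \<open>j\<close> are gone, \<open>te j\<close> is the
  only tree edge left at \<open>ch j\<close>.\<close>

definition tree_inv ::
    "(nat \<Rightarrow> nat) \<Rightarrow> nat \<Rightarrow> (nat \<Rightarrow> nat) \<Rightarrow> (nat \<Rightarrow> nat) \<Rightarrow> (nat \<Rightarrow> nat) \<Rightarrow> bool" where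
  "tree_inv vis slot te ch tree \<longleftrightarrow>
     (\<forall>v<n. vis v = 0 \<or> vis v = 1) \<and> vis 0 = 1 \<and>
     slot + card {v. v < n \<and> vis v = 1} = n \<and>
     (\<forall>j. slot \<le> j \<and> j < n - 1 \<longrightarrow> te j < m \<and> ch j \<in> ed (te j) \<and> (\<forall>v\<in>ed (te j). vis v = 1)) \<and>
     (\<forall>j k. slot \<le> j \<and> j < k \<and> k < n - 1 \<longrightarrow> ch j \<notin> ed (te k)) \<and>
     (\<forall>i<m. tree i = of_bool (i \<in> te ` {slot..<n - 1}))"

lemma tree_inv_init: "tree_inv ((\<lambda>_. 0)(0 := 1)) (n - 1) te ch (\<lambda>_. 0)"
proof -
  have "{v. v < n \<and> ((\<lambda>_. 0::nat)(0 := 1)) v = 1} = {0}" using n_pos by auto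
  then have "card {v. v < n \<and> ((\<lambda>_. 0::nat)(0 := 1)) v = 1} = 1" by simp
  then show ?thesis
    unfolding tree_inv_def by (intro conjI allI impI) (use n_pos in simp_all)
qed

text \<open>The new child \<open>v\<close> is unvisited, while all ends of older tree edges are
  visited; so \<open>v\<close> avoids those edges, which is the leaf order for the new slot. An
  unvisited vertex also means that a slot is free, so \<open>slot - 1\<close> is a genuine
  subtraction.\<close>

lemma tree_inv_add:
  assumes inv: "tree_inv vis slot te ch tree" and i: "i < m" and e: "ed i = {u, v}"
    and u: "vis u = 1" and v: "vis v = 0"
  shows "tree_inv (vis(v := 1)) (slot - 1) (te(slot - 1 := i)) (ch(slot - 1 := v)) (tree(i := 1))"
    and "0 < slot"
proof -
  have vn: "v < n" "u < n" using ends[OF i] e by (auto simp: ed_def doubleton_eq_iff)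
  let ?W = "{x. x < n \<and> vis x = 1}"
  have fin: "finite ?W" by simp
  have "v \<in> {..<n}" "v \<notin> ?W" using vn v by simp_all
  moreover have "?W \<subseteq> {..<n}" by (simp add: subset_iff)
  ultimately have "?W \<subset> {..<n}" by blast
  then have "card ?W < n" using psubset_card_mono[of "{..<n}" ?W] by simp
  then show pos: "0 < slot" using inv by (simp add: tree_inv_def)
  have "{x. x < n \<and> (vis(v := 1)) x = 1} = insert v ?W" using vn by auto
  then have card: "card {x. x < n \<and> (vis(v := 1)) x = 1} = Suc (card ?W)"
    using v fin by simp
  have "vis 0 = 1" using inv by (simp add: tree_inv_def)
  then have v0: "v \<noteq> 0" using v by (metis zero_neq_one)
  have old: "te j < m \<and> ch j \<in> ed (te j) \<and> (\<forall>v\<in>ed (te j). vis v = 1)"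
    if "slot \<le> j" "j < n - 1" for j
    using inv that by (simp add: tree_inv_def)
  have "slot \<le> n - 1"
  proof -
    have "0 \<in> ?W" using inv n_pos by (simp add: tree_inv_def)
    then have "0 < card ?W" using fin by (auto simp: card_gt_0_iff)
    moreover have "slot + card ?W = n" using inv unfolding tree_inv_def by blast
    ultimately show ?thesis by linarith
  qed
  then have img: "(te(slot - 1 := i)) ` {slot - 1..<n - 1} = insert i (te ` {slot..<n - 1})"
  proof -
    have "{slot - 1..<n - 1} = insert (slot - 1) {slot..<n - 1}"
      using pos \<open>slot \<le> n - 1\<close> by auto
    moreover have "(te(slot - 1 := i)) ` {slot..<n - 1} = te ` {slot..<n - 1}"
      using pos by (intro image_cong) auto
    ultimately show ?thesis by (simp only: image_insert fun_upd_same)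
  qed
  show "tree_inv (vis(v := 1)) (slot - 1) (te(slot - 1 := i)) (ch(slot - 1 := v)) (tree(i := 1))"
    unfolding tree_inv_def
  proof (intro conjI allI impI)
    fix j assume j: "slot - 1 \<le> j \<and> j < n - 1"
    show "(te(slot - 1 := i)) j < m" "(ch(slot - 1 := v)) j \<in> ed ((te(slot - 1 := i)) j)"
      using old[of j] j i e by (auto simp: fun_upd_def)
    show "\<forall>x\<in>ed ((te(slot - 1 := i)) j). (vis(v := 1)) x = 1"
      using old[of j] j i e u by (auto simp: fun_upd_def)
  next
    fix j k assume j: "slot - 1 \<le> j \<and> j < k \<and> k < n - 1"
    then have k: "slot \<le> k" "k \<noteq> slot - 1" using pos by auto
    show "(ch(slot - 1 := v)) j \<notin> ed ((te(slot - 1 := i)) k)"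
    proof (cases "j = slot - 1")
      case True
      then show ?thesis using k old[of k] j v by auto
    next
      case False
      then have "slot \<le> j" using j by linarith
      then show ?thesis using j k inv False by (simp add: tree_inv_def)
    qed
  next
    fix i' assume "i' < m"
    then show "(tree(i := 1)) i' = of_bool (i' \<in> (te(slot - 1 := i)) ` {slot - 1..<n - 1})"
      using inv unfolding img by (simp add: tree_inv_def)
  qed (use inv v0 pos card in \<open>auto simp: tree_inv_def\<close>)
qed

definition grow_inv :: "state \<Rightarrow> bool" where
  "grow_inv s \<longleftrightarrow> inp s \<and>
     tree_inv (narr s ''vis'') (nvar s ''slot'') (narr s ''te'') (narr s ''ch'') (narr s ''tree'')"

text \<open>A pass that fills no slot has changed nothing, and has then seen every edge with both
  ends visited or both unvisited.\<close>

lemma grow_scan: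
  assumes inv: "grow_inv s"
  shows "prun N (For ''i'' ''m'' grow_step) s (\<lambda>s'. grow_inv s' \<and>
    (nvar s' ''slot'' < nvar s ''slot'' \<or> nvar s' ''slot'' = nvar s ''slot'' \<and>
       (\<forall>i<m. narr s ''vis'' (src i) = narr s ''vis'' (dst i))))"
    (is "prun N _ s ?R")
proof -
  \<comment> \<open>While no slot is filled, \<open>vis\<close> is still the array from before the
    pass, so all comparisons made so far refer to one state.\<close>
  define I where "I i s' \<longleftrightarrow> grow_inv s' \<and>
    (nvar s' ''slot'' < nvar s ''slot'' \<or>
     nvar s' ''slot'' = nvar s ''slot'' \<and> narr s' ''vis'' = narr s ''vis'' \<and>
       (\<forall>i'<i. narr s ''vis'' (src i') = narr s ''vis'' (dst i')))" for i s'
  have vm: "nvar s ''m'' = m" using inv by (simp add: grow_inv_def inp_def)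
  show ?thesis
  proof (rule prun_For[where I = I])
    show "prun N grow_step s' (I (Suc i))"
      if "i < nvar s ''m''" and vi: "nvar s' ''i'' = i" and I: "I i s'" for i s'
    proof (rule prun_step)
      have i: "i < m" using that vm by simp
      have inp: "inp s'" and
        tr: "tree_inv (narr s' ''vis'') (nvar s' ''slot'') (narr s' ''te'') (narr s' ''ch'') (narr s' ''tree'')"
        using I by (auto simp: I_def grow_inv_def)
      have ends': "narr s' ''src'' i = src i" "narr s' ''dst'' i = dst i"
        using inp i by (auto simp: inp_def)
      have le: "nvar s' ''slot'' \<le> nvar s ''slot''" using I by (auto simp: I_def)
      note add = tree_inv_add[OF tr i]
      note a1 = add[of "src i" "dst i"] and a2 = add[of "dst i" "src i"]
      have 01: "narr s' ''vis'' (src i) = 0 \<or> narr s' ''vis'' (src i) = 1"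
        "narr s' ''vis'' (dst i) = 0 \<or> narr s' ''vis'' (dst i) = 1"
        using tr ends[OF i] by (auto simp: tree_inv_def)
      show "I (Suc i) (step grow_step s')"
      proof (cases "narr s' ''vis'' (src i) = narr s' ''vis'' (dst i)")
        case True
        then have "step grow_step s' = s'"
          using ends' vi by (auto simp: grow_step_def)
        then show ?thesis using I True by (auto simp: I_def less_Suc_eq)
      next
        case False
        then consider "narr s' ''vis'' (src i) = 1" "narr s' ''vis'' (dst i) = 0" |
          "narr s' ''vis'' (dst i) = 1" "narr s' ''vis'' (src i) = 0"
          using 01 by auto
        then show ?thesis
        proof cases
          case 1
          then have "nvar s' ''slot'' - 1 < nvar s ''slot''"
            using a1 le by (simp add: ed_def)
          then show ?thesis
            using a1 1 inp unfolding I_def grow_inv_def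
            by (simp add: grow_step_def add_edge_def ends' vi inp_def ed_def)
        next
          case 2
          then have "nvar s' ''slot'' - 1 < nvar s ''slot''"
            using a2 le by (simp add: ed_def insert_commute)
          then show ?thesis
            using a2 2 inp unfolding I_def grow_inv_def
            by (simp add: grow_step_def add_edge_def ends' vi inp_def ed_def insert_commute)
        qed
      qed
    qed (simp add: grow_step_def add_edge_def)
  qed (use inv bounds in \<open>auto simp: I_def grow_inv_def inp_def m_def grow_step_def add_edge_def\<close>)
qed

text \<open>If there is a Hamiltonian path, every pass fills a slot until none is free, so
  \<open>n\<close> passes suffice. A free slot at the end therefore rules out a Hamiltonian
  path.\<close>

lemma grow_tree_correct:
  assumes inp: "inp s" and zero: "narr s ''vis'' = (\<lambda>_. 0)" "narr s ''tree'' = (\<lambda>_. 0)"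
  shows "prun N grow_tree s (\<lambda>s'. grow_inv s' \<and>
    (nvar s' ''slot'' = 0 \<or> (\<nexists>vs. hamiltonian_path {..<n} E vs)))"
proof -
  let ?H = "\<exists>vs. hamiltonian_path {..<n} E vs"
  \<comment> \<open>The initial value of \<open>slot\<close> is \<open>n - 1\<close>, so the
    inequality holds for \<open>a = 0\<close>; for \<open>a = n\<close> it is impossible, which
    leaves \<open>slot = 0\<close>.\<close>
  define I where "I a s' \<longleftrightarrow> grow_inv s' \<and>
    (?H \<longrightarrow> nvar s' ''slot'' = 0 \<or> nvar s' ''slot'' + a < n)" for a s'
  have loop: "prun N (For ''a'' ''n'' (For ''i'' ''m'' grow_step)) s1
      (\<lambda>s'. grow_inv s' \<and> (nvar s' ''slot'' = 0 \<or> \<not> ?H))"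
    if s1: "grow_inv s1" "nvar s1 ''slot'' < n" for s1
  proof (rule prun_For[where I = I])
    have vn: "nvar s1 ''n'' = n" using s1 by (simp add: grow_inv_def inp_def)
    then show "nvar s1 ''n'' \<le> N" using bounds by simp
    show "I 0 s1" using s1 by (simp add: I_def)
    show "prun N (For ''i'' ''m'' grow_step) s' (I (Suc a))" if I: "I a s'" for a s'
    proof (rule prun_conseq)
      show "prun N (For ''i'' ''m'' grow_step) s' (\<lambda>s''. grow_inv s'' \<and>
        (nvar s'' ''slot'' < nvar s' ''slot'' \<or> nvar s'' ''slot'' = nvar s' ''slot'' \<and>
          (\<forall>i<m. narr s' ''vis'' (src i) = narr s' ''vis'' (dst i))))"
        using I by (intro grow_scan) (simp add: I_def)
      fix s'' assume s'': "grow_inv s'' \<and>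
        (nvar s'' ''slot'' < nvar s' ''slot'' \<or> nvar s'' ''slot'' = nvar s' ''slot'' \<and>
          (\<forall>i<m. narr s' ''vis'' (src i) = narr s' ''vis'' (dst i)))"
      \<comment> \<open>A pass without progress would leave no edge between visited and unvisited
        vertices, although the Hamiltonian path crosses this cut.\<close>
      have "nvar s'' ''slot'' < nvar s' ''slot''" if H: ?H and pos: "0 < nvar s' ''slot''"
      proof (rule ccontr)
        assume "\<not> ?thesis"
        then have same: "\<forall>i<m. narr s' ''vis'' (src i) = narr s' ''vis'' (dst i)"
          using s'' by auto
        obtain vs where vs: "hamiltonian_path {..<n} E vs" using H by blast
        let ?W = "{v. v < n \<and> narr s' ''vis'' v = 1}"
        have inv: "narr s' ''vis'' 0 = 1" "nvar s' ''slot'' + card ?W = n"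
          using I by (auto simp: I_def grow_inv_def tree_inv_def)
        have "card ?W \<noteq> card {..<n}" using inv(2) pos by simp
        then have "?W \<noteq> {..<n}" by metis
        moreover have "?W \<subseteq> {..<n}" by (simp add: subset_iff)
        ultimately have "\<exists>e\<in>E. \<exists>u v. e = {u, v} \<and> u \<in> ?W \<and> v \<in> {..<n} - ?W"
          using inv(1) n_pos by (intro connected_step[OF vs, of 0]) (simp_all add: psubset_eq)
        then obtain i u v where "i < m" "ed i = {u, v}" "u \<in> ?W" "v \<in> {..<n} - ?W"
          using E_eq by auto
        then show False using same by (auto simp: ed_def doubleton_eq_iff)
      qed
      then show "I (Suc a) s''"
        using s'' I unfolding I_def by force
    qed
    show "grow_inv s' \<and> (nvar s' ''slot'' = 0 \<or> \<not> ?H)" if "I (nvar s1 ''n'') s'" for s'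
      using that vn by (auto simp: I_def)
  qed (auto simp: I_def grow_inv_def inp_def grow_step_def add_edge_def)
  have vn: "nvar s ''n'' = n" using inp by (simp add: inp_def)
  show ?thesis
    unfolding grow_tree_def
  proof (rule prun_step_Seq, simp, rule prun_step_Seq, simp)
    show "prun N (For ''a'' ''n'' (For ''i'' ''m'' grow_step))
        (step (NStore ''vis'' (Const 0) (Const 1)) (step (NAssign ''slot'' (Pred (NVar ''n''))) s))
        (\<lambda>s'. grow_inv s' \<and> (nvar s' ''slot'' = 0 \<or> \<not> ?H))"
      using inp n_pos tree_inv_init vn zero
      by (intro loop) (auto simp: grow_inv_def inp_def)
  qed
qed

end

section \<open>Generating a candidate\<close>

definition bump :: "nexp \<Rightarrow> com" where
  "bump v = NStore ''deg'' v (Succ (NArr ''deg'' v))"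

text \<open>The units at \<open>s\<close> and \<open>t\<close> stand for the missing neighbors of
  the two ends.\<close>

definition init_deg :: com where
  "init_deg = Seq (For ''i'' ''n'' (NStore ''deg'' var_i (Const 0)))
     (Seq (bump (NVar ''s'')) (bump (NVar ''t'')))"

definition use_edge :: com where
  "use_edge = Seq (NStore ''use'' var_i (Const 1)) (Seq (bump src_i) (bump dst_i))"

definition drop_edge :: com where
  "drop_edge = NStore ''use'' var_i (Const 0)"

definition select :: com where
  "select = For ''i'' ''m''
     (Cond (NEq (NArr ''tree'' var_i) (Const 0))
       (Cond (NEq (NArr ''sel'' var_i) (Const 1)) use_edge drop_edge)
       Skip)"

text \<open>When slot \<open>j\<close> is reached, \<open>te j\<close> is the only undecided edge at
  \<open>ch j\<close>; it is used exactly if \<open>ch j\<close> still lacks degree.\<close>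

definition peel :: com where
  "peel = For ''j'' ''l''
     (Seq (NAssign ''i'' (NArr ''te'' (NVar ''j'')))
       (Cond (NLess (NArr ''deg'' (NArr ''ch'' (NVar ''j''))) (Const 2)) use_edge drop_edge))"

text \<open>An edge is deleted from \<open>use\<close> when it is traversed, so the walk cannot turn
  back.\<close>

definition walk_step :: com where
  "walk_step = Cond (NEq (NArr ''use'' var_i) (Const 1))
     (Cond (NEq src_i (NArr ''w'' (NVar ''j'')))
       (Seq (NStore ''use'' var_i (Const 0)) (NStore ''w'' (Succ (NVar ''j'')) dst_i))
       (Cond (NEq dst_i (NArr ''w'' (NVar ''j'')))
         (Seq (NStore ''use'' var_i (Const 0)) (NStore ''w'' (Succ (NVar ''j'')) src_i))
         Skip))
     Skip"

definition walk :: com where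
  "walk = Seq (NStore ''w'' (Const 0) (NVar ''s''))
     (For ''j'' ''l'' (For ''i'' ''m'' walk_step))"

definition generate :: com where
  "generate = Seq init_deg (Seq select (Seq peel walk))"

lemmas program_defs = bump_def init_deg_def use_edge_def drop_edge_def select_def peel_def
  walk_step_def walk_def generate_def

text \<open>The tree is passed on to the generator through its leaf order, from which also the
  distinctness of the edges \<open>te j\<close> follows.\<close>

locale spanned_instance = poh_instance +
  fixes te ch :: "nat \<Rightarrow> nat"
  assumes te_less: "j < n - 1 \<Longrightarrow> te j < m"
    and ch_in: "j < n - 1 \<Longrightarrow> ch j \<in> ed (te j)"
    and ch_notin: "j < k \<Longrightarrow> k < n - 1 \<Longrightarrow> ch j \<notin> ed (te k)"
begin

definition in_tree :: "nat \<Rightarrow> bool" where "in_tree i \<longleftrightarrow> i \<in> te ` {..<n - 1}"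

text \<open>A repeated edge would contain the child of its lower slot again in the higher one. This
  makes the number of tree edges exactly \<open>n - 1\<close>.\<close>

lemma inj_te: "inj_on te {..<n - 1}"
proof (rule inj_onI)
  fix j k assume jk: "j \<in> {..<n - 1}" "k \<in> {..<n - 1}" "te j = te k"
  show "j = k"
  proof (rule linorder_cases)
    assume "j < k"
    then show ?thesis using jk ch_in[of j] ch_notin[of j k] by simp
  next
    assume "k < j"
    then show ?thesis using jk ch_in[of k] ch_notin[of k j] by simp
  qed
qed

lemma ch_less: "j < n - 1 \<Longrightarrow> ch j < n"
  using ends(1,2)[OF te_less, of j] ch_in[of j] by (auto simp: ed_def)

text \<open>The numbers of consecutive pairs to be walked and to be checked are kept in
  \<open>l\<close> and \<open>len\<close> because \<open>For\<close> reads its bound from a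
  variable.\<close>

definition data :: "state \<Rightarrow> bool" where
  "data s \<longleftrightarrow> inp s \<and> nvar s ''l'' = n - 1 \<and>
     nvar s ''len'' = (if cyc then n else n - 1) \<and>
     (\<forall>j<n - 1. narr s ''te'' j = te j \<and> narr s ''ch'' j = ch j) \<and>
     (\<forall>i<m. narr s ''tree'' i = of_bool (in_tree i))"

lemma data_frame:
  assumes "data s" "frame P s s'" "nvar_writes P \<inter> {''n'', ''m'', ''p'', ''l'', ''len''} = {}"
    "narr_writes P \<inter> {''src'', ''dst'', ''lower'', ''upper'', ''te'', ''ch'', ''tree''} = {}"
    "''cost'' \<notin> rarr_writes P"
  shows "data s'"
proof -
  have "inp s'" using assms by (intro inp_frame[of s P s']) (auto simp: data_def)
  with assms show ?thesis by (simp add: data_def frame_def)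
qed

text \<open>The inputs of the generator that come from the path \<open>vs\<close>; only for these is
  anything claimed about its result.\<close>

definition matches :: "state \<Rightarrow> nat list \<Rightarrow> bool" where
  "matches s vs \<longleftrightarrow> hamiltonian_path {..<n} E vs \<and> hd vs = nvar s ''s'' \<and> last vs = nvar s ''t'' \<and>
     (\<forall>i<m. \<not> in_tree i \<longrightarrow> narr s ''sel'' i = of_bool (ed i \<in> path_edges vs))"

text \<open>\<open>P\<close> is meant as the set of edge indices already decided; the counted degree
  includes the units granted to the ends.\<close>

definition partial_degree :: "nat list \<Rightarrow> nat set \<Rightarrow> nat \<Rightarrow> nat" where
  "partial_degree vs P v = of_bool (v = hd vs) + of_bool (v = last vs) +
     card {i \<in> P. ed i \<in> path_edges vs \<and> v \<in> ed i}"

lemma partial_degree_insert: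
  assumes "finite P" "i \<notin> P"
  shows "partial_degree vs (insert i P) v =
    partial_degree vs P v + of_bool (ed i \<in> path_edges vs \<and> v \<in> ed i)"
proof (cases "ed i \<in> path_edges vs \<and> v \<in> ed i")
  case True
  then have "{i' \<in> insert i P. ed i' \<in> path_edges vs \<and> v \<in> ed i'} =
    insert i {i' \<in> P. ed i' \<in> path_edges vs \<and> v \<in> ed i'}" by blast
  then show ?thesis using assms True by (simp add: partial_degree_def)
next
  case False
  then have "{i' \<in> insert i P. ed i' \<in> path_edges vs \<and> v \<in> ed i'} =
    {i' \<in> P. ed i' \<in> path_edges vs \<and> v \<in> ed i'}" by blast
  then show ?thesis using False by (simp add: partial_degree_def)
qed

lemma path_edges_subset: "hamiltonian_path {..<n} E vs \<Longrightarrow> path_edges vs \<subseteq> E"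
  by (auto simp: hamiltonian_path_def path_edges_def)

lemma hamiltonian_path_length: "hamiltonian_path {..<n} E vs \<Longrightarrow> length vs = n"
  by (metis card_lessThan distinct_card hamiltonian_path_def)

lemma full_degree:
  assumes hp: "hamiltonian_path {..<n} E vs" and v: "v < n"
  shows "partial_degree vs {..<m} v = 2"
proof -
  have d: "distinct vs" and s: "set vs = {..<n}" using hp by (auto simp: hamiltonian_path_def)
  obtain a where a: "a < length vs" "vs ! a = v" using s v by (metis in_set_conv_nth lessThan_iff)
  have img: "ed ` {i \<in> {..<m}. ed i \<in> path_edges vs \<and> v \<in> ed i} = {e \<in> path_edges vs. v \<in> e}"
    using path_edges_subset[OF hp] E_eq by auto
  have "inj_on ed {i \<in> {..<m}. ed i \<in> path_edges vs \<and> v \<in> ed i}"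
    using inj_ed by (rule inj_on_subset) auto
  from card_image[OF this] have "card {i \<in> {..<m}. ed i \<in> path_edges vs \<and> v \<in> ed i} = card {e \<in> path_edges vs. v \<in> e}"
    unfolding img by (rule sym)
  moreover have ne: "vs \<noteq> []" using a by auto
  have "v = hd vs \<longleftrightarrow> a = 0"
    using a d ne by (auto simp: hd_conv_nth nth_eq_iff_index_eq)
  moreover have "v = last vs \<longleftrightarrow> Suc a = length vs"
    using a d ne by (auto simp: last_conv_nth nth_eq_iff_index_eq)
  ultimately show ?thesis
    using path_degree[OF d a(1)] a(2) by (simp add: partial_degree_def)
qed

definition deg_inv :: "nat list \<Rightarrow> nat set \<Rightarrow> (nat \<Rightarrow> nat) \<Rightarrow> (nat \<Rightarrow> nat) \<Rightarrow> bool" where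
  "deg_inv vs P deg use \<longleftrightarrow> (\<forall>v<n. deg v = partial_degree vs P v) \<and>
     (\<forall>i\<in>P. use i = of_bool (ed i \<in> path_edges vs))"

lemma deg_inv_use:
  assumes "deg_inv vs P deg use" "finite P" "i \<notin> P" "i < m" "ed i \<in> path_edges vs"
  shows "deg_inv vs (insert i P) (deg(src i := Suc (deg (src i)), dst i := Suc (deg (dst i))))
    (use(i := 1))"
  using assms ends[of i] by (auto simp: deg_inv_def partial_degree_insert ed_def)

lemma deg_inv_drop:
  assumes "deg_inv vs P deg use" "finite P" "i \<notin> P" "i < m" "ed i \<notin> path_edges vs"
  shows "deg_inv vs (insert i P) deg (use(i := 0))"
  using assms by (auto simp: deg_inv_def partial_degree_insert)

lemma init_deg_correct:
  assumes "data s" "nvar s ''s'' < n" "nvar s ''t'' < n"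
  shows "prun N init_deg s
    (\<lambda>s'. \<forall>v<n. narr s' ''deg'' v = of_bool (v = nvar s ''s'') + of_bool (v = nvar s ''t''))"
proof -
  have vn: "nvar s ''n'' = n" using assms by (simp add: data_def inp_def)
  \<comment> \<open>Clearing is necessary since earlier candidates have left their degrees
    behind.\<close>
  have "prun N (For ''i'' ''n'' (NStore ''deg'' var_i (Const 0))) s
    (\<lambda>s'. \<forall>v<n. narr s' ''deg'' v = 0)"
  proof (rule prun_For[where I = "\<lambda>i s'. \<forall>v<i. narr s' ''deg'' v = 0"])
    show "prun N (NStore ''deg'' var_i (Const 0)) s' (\<lambda>s'. \<forall>v<Suc i. narr s' ''deg'' v = 0)"
      if "nvar s' ''i'' = i" "\<forall>v<i. narr s' ''deg'' v = 0" for i s'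
      by (rule prun_step) (use that in \<open>auto simp: less_Suc_eq\<close>)
  qed (use vn bounds in auto)
  then show ?thesis
    unfolding init_deg_def
  proof (intro prun_Seq, elim prun_conseq)
    fix s' assume fr: "frame (For ''i'' ''n'' (NStore ''deg'' var_i (Const 0))) s s'"
      and zero: "\<forall>v<n. narr s' ''deg'' v = 0"
    have "nvar s' ''s'' = nvar s ''s''" "nvar s' ''t'' = nvar s ''t''"
      using fr by (simp_all add: frame_nvar)
    then show "prun N (Seq (bump (NVar ''s'')) (bump (NVar ''t''))) s'
      (\<lambda>s'. \<forall>v<n. narr s' ''deg'' v = of_bool (v = nvar s ''s'') + of_bool (v = nvar s ''t''))"
      by (intro prun_step) (use zero assms in \<open>auto simp: bump_def\<close>)
  qed
qed

text \<open>The premise \<open>matches s vs\<close> sits inside the postcondition because the time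
  bound must also hold for choices that belong to no path.\<close>

lemma select_correct:
  assumes data: "data s"
    and inv: "matches s vs \<Longrightarrow> \<forall>v<n. narr s ''deg'' v = of_bool (v = hd vs) + of_bool (v = last vs)"
  shows "prun N select s (\<lambda>s'. matches s vs \<longrightarrow>
    deg_inv vs {i. i < m \<and> \<not> in_tree i} (narr s' ''deg'') (narr s' ''use''))"
proof -
  define P where "P i = {i'. i' < i \<and> \<not> in_tree i'}" for i
  have vm: "nvar s ''m'' = m" using data by (simp add: data_def inp_def)
  show ?thesis
    unfolding select_def
  proof (rule prun_For[where I = "\<lambda>i s'. matches s vs \<longrightarrow>
      deg_inv vs (P i) (narr s' ''deg'') (narr s' ''use'')"], goal_cases)
    case (7 i s')
    have i: "i < m" using 7 vm by simp
    have d: "data s'"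
      using data 7(3) by (rule data_frame) (simp_all add: program_defs)
    have "narr s' ''sel'' = narr s ''sel''"
      using 7(3) by (simp add: frame_narr program_defs)
    then have sel: "narr s' ''sel'' i = of_bool (ed i \<in> path_edges vs)" if "\<not> in_tree i" "matches s vs"
      using that i by (simp add: matches_def)
    have ends': "narr s' ''src'' i = src i" "narr s' ''dst'' i = dst i" "src i \<noteq> dst i"
      and tree: "narr s' ''tree'' i = of_bool (in_tree i)"
      using d i ends[OF i] by (auto simp: data_def inp_def)
    have fin: "finite (P i)" "i \<notin> P i" by (auto simp: P_def)
    show ?case
    proof (intro prun_step impI)
      assume m: "matches s vs"
      have inv: "deg_inv vs (P i) (narr s' ''deg'') (narr s' ''use'')" using 7(4) m by simp
      show "deg_inv vs (P (Suc i)) (narr (step (Cond (NEq (NArr ''tree'' var_i) (Const 0))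
        (Cond (NEq (NArr ''sel'' var_i) (Const 1)) use_edge drop_edge) Skip) s') ''deg'')
        (narr (step (Cond (NEq (NArr ''tree'' var_i) (Const 0))
        (Cond (NEq (NArr ''sel'' var_i) (Const 1)) use_edge drop_edge) Skip) s') ''use'')"
      proof (cases "in_tree i")
        case True
        then have "P (Suc i) = P i" by (auto simp: P_def less_Suc_eq)
        then show ?thesis using inv 7(2) tree True by simp
      next
        case False
        then have "P (Suc i) = insert i (P i)" by (auto simp: P_def less_Suc_eq)
        then show ?thesis
          using False deg_inv_use[OF inv fin i] deg_inv_drop[OF inv fin i] sel[OF False m]
            7(2) tree ends'
          by (auto simp: program_defs)
      qed
    qed (simp add: program_defs)
  next
    case 5
    then show ?case using inv by (simp add: P_def deg_inv_def partial_degree_def)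
  next
    case (8 s')
    then show ?case using vm by (simp add: P_def)
  qed (use vm bounds in \<open>auto simp: m_def program_defs\<close>)
qed

text \<open>The full degree of \<open>ch j\<close> is two, and all its edges other than
  \<open>te j\<close> are decided, so the degree counted so far is one or two and tells whether
  \<open>te j\<close> is on the path.\<close>

lemma peel_correct:
  assumes data: "data s"
    and inv: "matches s vs \<Longrightarrow>
      deg_inv vs {i. i < m \<and> \<not> in_tree i} (narr s ''deg'') (narr s ''use'')"
  shows "prun N peel s (\<lambda>s'. matches s vs \<longrightarrow>
    (\<forall>i<m. narr s' ''use'' i = of_bool (ed i \<in> path_edges vs)))"
proof -
  \<comment> \<open>The decided edges: all non-tree edges and those in the first \<open>j\<close>
    slots.\<close>
  define P where "P j = {i. i < m \<and> \<not> in_tree i} \<union> te ` {..<j}" for j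
  have vl: "nvar s ''l'' = n - 1" using data by (simp add: data_def)
  show ?thesis
    unfolding peel_def
  proof (rule prun_For[where I = "\<lambda>j s'. matches s vs \<longrightarrow>
      deg_inv vs (P j) (narr s' ''deg'') (narr s' ''use'')"], goal_cases)
    case (7 j s')
    have j: "j < n - 1" using 7 vl by simp
    define i where "i = te j"
    have i: "i < m" using te_less[OF j] by (simp add: i_def)
    have d: "data s'"
      using data 7(3) by (rule data_frame) (simp_all add: program_defs)
    have ends': "narr s' ''src'' i = src i" "narr s' ''dst'' i = dst i" "src i \<noteq> dst i"
      and tc: "narr s' ''te'' j = i" "narr s' ''ch'' j = ch j"
      using d i j ends[OF i] by (auto simp: data_def inp_def i_def)
    have fin: "finite (P j)" by (simp add: P_def)
    have notin: "te k \<notin> P j" if "j \<le> k" "k < n - 1" for k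
      using that by (auto simp: P_def in_tree_def dest!: inj_onD[OF inj_te])
    have iP: "i \<notin> P j" using notin[of j] j by (simp add: i_def)
    have P: "P (Suc j) = insert i (P j)" by (auto simp: P_def less_Suc_eq i_def)
    show ?case
    proof (intro prun_step impI)
      assume m: "matches s vs"
      then have hp: "hamiltonian_path {..<n} E vs" by (simp add: matches_def)
      have inv: "deg_inv vs (P j) (narr s' ''deg'') (narr s' ''use'')" using 7(4) m by simp
      have "{..<m} = P j \<union> te ` {j..<n - 1}"
      proof -
        have "te ` {..<j} \<union> te ` {j..<n - 1} = te ` {..<n - 1}"
          using j by (metis image_Un ivl_disj_un_one(2) less_imp_le)
        moreover have "te ` {..<n - 1} \<subseteq> {..<m}" using te_less by auto
        ultimately show ?thesis unfolding P_def in_tree_def by blast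
      qed
      \<comment> \<open>By the leaf order, the undecided edges beyond slot \<open>j\<close> avoid
        \<open>ch j\<close>.\<close>
      then have "{i' \<in> {..<m}. ed i' \<in> path_edges vs \<and> ch j \<in> ed i'} =
        {i' \<in> insert i (P j). ed i' \<in> path_edges vs \<and> ch j \<in> ed i'}"
        using ch_notin j by (auto simp: i_def le_less)
      then have "partial_degree vs {..<m} (ch j) = partial_degree vs (insert i (P j)) (ch j)"
        by (simp add: partial_degree_def)
      then have "2 = partial_degree vs (P j) (ch j) + of_bool (ed i \<in> path_edges vs)"
        using full_degree[OF hp ch_less[OF j]] ch_in[OF j]
          partial_degree_insert[OF fin iP, of vs "ch j"]
        by (simp add: i_def)
      then have deg: "narr s' ''deg'' (ch j) < 2 \<longleftrightarrow> ed i \<in> path_edges vs"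
        using inv ch_less[OF j] by (cases "ed i \<in> path_edges vs") (auto simp: deg_inv_def)
      then show "deg_inv vs (P (Suc j)) (narr (step (Seq (NAssign ''i'' (NArr ''te'' (NVar ''j'')))
        (Cond (NLess (NArr ''deg'' (NArr ''ch'' (NVar ''j''))) (Const 2)) use_edge drop_edge)) s') ''deg'')
        (narr (step (Seq (NAssign ''i'' (NArr ''te'' (NVar ''j'')))
        (Cond (NLess (NArr ''deg'' (NArr ''ch'' (NVar ''j''))) (Const 2)) use_edge drop_edge)) s') ''use'')"
        using deg_inv_use[OF inv fin iP i] deg_inv_drop[OF inv fin iP i] 7(2) tc ends'
        unfolding P by (auto simp: program_defs)
    qed (simp add: program_defs)
  next
    case 5
    then show ?case using inv by (simp add: P_def)
  next
    case (8 s')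
    have "i \<in> P (n - 1)" if "i < m" for i
      using that by (auto simp: P_def in_tree_def)
    then show ?case using 8 vl by (auto simp: deg_inv_def)
  qed (use vl bounds in \<open>auto simp: m_def program_defs\<close>)
qed

text \<open>After \<open>j\<close> rounds the edges still marked in \<open>use\<close> are those of
  the path from position \<open>j\<close> on. \<open>M\<close> carries an assumption about another
  state; the caller takes \<open>matches\<close> in the state before the walk.\<close>

lemma walk_scan:
  assumes data: "data s" and j: "nvar s ''j'' = j" "j < n - 1"
    and inv: "hamiltonian_path {..<n} E vs \<Longrightarrow> M \<Longrightarrow> (\<forall>q\<le>j. narr s ''w'' q = vs ! q) \<and>
      (\<forall>i<m. narr s ''use'' i = of_bool (\<exists>q\<ge>j. Suc q < n \<and> ed i = {vs ! q, vs ! Suc q}))"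
  shows "prun N (For ''i'' ''m'' walk_step) s (\<lambda>s'. hamiltonian_path {..<n} E vs \<longrightarrow> M \<longrightarrow>
      (\<forall>q\<le>Suc j. narr s' ''w'' q = vs ! q) \<and>
      (\<forall>i<m. narr s' ''use'' i = of_bool (\<exists>q\<ge>Suc j. Suc q < n \<and> ed i = {vs ! q, vs ! Suc q})))"
proof -
  have vm: "nvar s ''m'' = m" using data by (simp add: data_def inp_def)
  define later where "later q0 i \<longleftrightarrow> (\<exists>q\<ge>q0. Suc q < n \<and> ed i = {vs ! q, vs ! Suc q})" for q0 i
  \<comment> \<open>In the middle of a scan, edges below \<open>i\<close> are already in the state
    for position \<open>Suc j\<close>, the others still in that for \<open>j\<close>.\<close>
  define K where "K i w use \<longleftrightarrow> (\<forall>q\<le>j. w q = vs ! q) \<and>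
    (\<forall>i'<m. use i' = of_bool (later (if i' < i then Suc j else j) i')) \<and>
    (\<forall>i'<i. ed i' = {vs ! j, vs ! Suc j} \<longrightarrow> w (Suc j) = vs ! Suc j)"
    for i :: nat and w use :: "nat \<Rightarrow> nat"
  show ?thesis
  proof (rule prun_For[where I = "\<lambda>i s'. hamiltonian_path {..<n} E vs \<longrightarrow> M \<longrightarrow>
      K i (narr s' ''w'') (narr s' ''use'')"], goal_cases)
    case (7 i s')
    have i: "i < m" using 7 vm by simp
    have d: "data s'"
      using data 7(3) by (rule data_frame) (simp_all add: program_defs)
    have ends': "narr s' ''src'' i = src i" "narr s' ''dst'' i = dst i" "src i \<noteq> dst i"
      using d i ends[OF i] by (auto simp: data_def inp_def)
    have vj: "nvar s' ''j'' = j" using 7(3) j by (simp add: frame_nvar program_defs)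
    show ?case
    proof (intro prun_step impI)
      assume hp: "hamiltonian_path {..<n} E vs" and M
      then have K: "K i (narr s' ''w'') (narr s' ''use'')" using 7(4) by simp
      have d: "distinct vs" and len: "length vs = n"
        using hp hamiltonian_path_length by (auto simp: hamiltonian_path_def)
      have eq: "vs ! a = vs ! b \<longleftrightarrow> a = b" if "a < n" "b < n" for a b
        using that d len by (simp add: nth_eq_iff_index_eq)
      have later: "later j i \<longleftrightarrow> ed i = {vs ! j, vs ! Suc j} \<or> later (Suc j) i"
      proof -
        have "j \<le> q \<longleftrightarrow> q = j \<or> Suc j \<le> q" for q by auto
        moreover have "Suc j < n" using j(2) by simp
        ultimately show ?thesis unfolding later_def by metis
      qed
      \<comment> \<open>Vertices on the path are distinct, so later path edges avoid
        \<open>vs ! j\<close> and the scan can only take the edge to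
        \<open>vs ! Suc j\<close>.\<close>
      have off: "vs ! j \<notin> ed i" if "later (Suc j) i"
        using that eq unfolding later_def by fastforce
      have use: "narr s' ''use'' i = of_bool (later j i)"
        using K i by (simp add: K_def)
      have wj: "narr s' ''w'' j = vs ! j" using K by (simp add: K_def)
      have upd: "K (Suc i) (w(Suc j := vs ! Suc j)) (use(i := 0))"
        if "K i w use" "ed i = {vs ! j, vs ! Suc j}" for w use
      proof -
        have "\<not> later (Suc j) i" using off that(2) by auto
        then show ?thesis using that(1) i j(2) unfolding K_def by (simp add: less_Suc_eq)
      qed
      have keep: "K (Suc i) w use" if "K i w use" "ed i \<noteq> {vs ! j, vs ! Suc j}" for w use
        using that(1) later that(2) unfolding K_def by (simp add: less_Suc_eq)
      show "K (Suc i) (narr (step walk_step s') ''w'') (narr (step walk_step s') ''use'')"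
      proof (cases "ed i = {vs ! j, vs ! Suc j}")
        case True
        then have "src i = vs ! j \<and> dst i = vs ! Suc j \<or> dst i = vs ! j \<and> src i = vs ! Suc j"
          by (auto simp: ed_def doubleton_eq_iff)
        moreover have "later j i" using True later by simp
        ultimately show ?thesis
          using upd[OF K True] 7(2) vj use wj ends' by (auto simp: program_defs)
      next
        case False
        have "step walk_step s' = s'"
        proof (cases "later j i")
          case True
          then have "src i \<noteq> vs ! j" "dst i \<noteq> vs ! j"
            using off later False by (auto simp: ed_def)
          then show ?thesis using 7(2) vj wj ends' by (simp add: program_defs)
        next
          case False
          then show ?thesis using 7(2) use by (simp add: program_defs)
        qed
        then show ?thesis using keep[OF K False] by simp
      qed
    qed (simp add: program_defs)
  next
    case 5
    then show ?case using inv by (auto simp: K_def later_def)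
  next
    case (8 s')
    show ?case
    proof (intro impI)
      assume hp: "hamiltonian_path {..<n} E vs" and M
      then have K: "K m (narr s' ''w'') (narr s' ''use'')" using 8 vm by simp
      have "{vs ! j, vs ! Suc j} \<in> E"
        using hp hamiltonian_path_length[OF hp] j by (auto simp: hamiltonian_path_def)
      \<comment> \<open>The next path edge has an index below \<open>m\<close>, so the completed
        scan has met it.\<close>
      then have "narr s' ''w'' (Suc j) = vs ! Suc j"
        using K E_eq unfolding K_def by force
      then show "(\<forall>q\<le>Suc j. narr s' ''w'' q = vs ! q) \<and>
        (\<forall>i<m. narr s' ''use'' i = of_bool (\<exists>q\<ge>Suc j. Suc q < n \<and> ed i = {vs ! q, vs ! Suc q}))"
        using K by (auto simp: K_def later_def le_Suc_eq)
    qed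
  qed (use vm bounds in \<open>auto simp: m_def program_defs\<close>)
qed

lemma walk_correct:
  assumes data: "data s"
    and inv: "matches s vs \<Longrightarrow> \<forall>i<m. narr s ''use'' i = of_bool (ed i \<in> path_edges vs)"
  shows "prun N walk s (\<lambda>s'. matches s vs \<longrightarrow> (\<forall>q<n. narr s' ''w'' q = vs ! q))"
proof -
  have vl: "nvar s ''l'' = n - 1" using data by (simp add: data_def)
  define J where "J j s' \<longleftrightarrow> (\<forall>q\<le>j. narr s' ''w'' q = vs ! q) \<and>
    (\<forall>i<m. narr s' ''use'' i = of_bool (\<exists>q\<ge>j. Suc q < n \<and> ed i = {vs ! q, vs ! Suc q}))"
    for j and s' :: state
  let ?s = "step (NStore ''w'' (Const 0) (NVar ''s'')) s"
  have m_hp: "hamiltonian_path {..<n} E vs" if "matches s vs"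
    using that by (simp add: matches_def)
  show ?thesis
    unfolding walk_def
  proof (rule prun_step_Seq, simp, rule prun_For[where I = "\<lambda>j s'. matches s vs \<longrightarrow> J j s'"], goal_cases)
    case (7 j s')
    have d: "data ?s" using data by (simp add: data_def inp_def)
    then have d: "data s'"
      using 7(3) by (rule data_frame) (simp_all add: program_defs)
    have "prun N (For ''i'' ''m'' walk_step) s' (\<lambda>s'. hamiltonian_path {..<n} E vs \<longrightarrow>
      matches s vs \<longrightarrow> J (Suc j) s')"
      unfolding J_def
      by (rule walk_scan[OF d]) (use 7 vl in \<open>auto simp: J_def\<close>)
    then show ?case
      by (rule prun_conseq) (use m_hp in blast)
  next
    case 5
    show ?case
    proof
      assume m: "matches s vs"
      have "length vs = n" using m_hp[OF m] by (rule hamiltonian_path_length)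
      moreover from this have "vs ! 0 = nvar s ''s''"
        using m n_pos by (metis hd_conv_nth length_greater_0_conv matches_def)
      ultimately show "J 0 ?s" using inv[OF m] by (simp add: J_def path_edges_def conj_commute)
    qed
  next
    case (8 s')
    then show ?case using vl by (auto simp: J_def)
  qed (use vl bounds in \<open>auto simp: J_def m_def program_defs\<close>)
qed

text \<open>The quantifier over \<open>vs\<close> follows the run: one deterministic run serves
  every matching path, and \<open>vs\<close> may be chosen afterwards.\<close>

lemma generate_correct:
  assumes data: "data s" and st: "nvar s ''s'' < n" "nvar s ''t'' < n"
  shows "prun N generate s (\<lambda>s'. \<forall>vs. matches s vs \<longrightarrow> (\<forall>q<n. narr s' ''w'' q = vs ! q))"
proof (rule run_all)
  fix vs
  show "prun N generate s (\<lambda>s'. matches s vs \<longrightarrow> (\<forall>q<n. narr s' ''w'' q = vs ! q))"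
    unfolding generate_def
  proof (rule prun_Seq, rule prun_conseq[OF init_deg_correct[OF data st]])
    fix s1 assume f1: "frame init_deg s s1"
      and 1: "\<forall>v<n. narr s1 ''deg'' v = of_bool (v = nvar s ''s'') + of_bool (v = nvar s ''t'')"
    have d1: "data s1" using data f1 by (rule data_frame) (simp_all add: program_defs)
    have m1: "matches s1 vs \<longleftrightarrow> matches s vs"
      using f1 by (simp add: matches_def frame_simps program_defs)
    have "prun N select s1 (\<lambda>s2. matches s1 vs \<longrightarrow>
        deg_inv vs {i. i < m \<and> \<not> in_tree i} (narr s2 ''deg'') (narr s2 ''use''))"
      using d1 by (rule select_correct) (use 1 m1 in \<open>auto simp: matches_def\<close>)
    then show "prun N (Seq select (Seq peel walk)) s1
      (\<lambda>s'. matches s vs \<longrightarrow> (\<forall>q<n. narr s' ''w'' q = vs ! q))"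
    proof (intro prun_Seq, elim prun_conseq)
      fix s2 assume f2: "frame select s1 s2" and 2: "matches s1 vs \<longrightarrow>
        deg_inv vs {i. i < m \<and> \<not> in_tree i} (narr s2 ''deg'') (narr s2 ''use'')"
      have d2: "data s2" using d1 f2 by (rule data_frame) (simp_all add: program_defs)
      have m2: "matches s2 vs \<longleftrightarrow> matches s vs"
        using f2 unfolding m1[symmetric] by (simp add: matches_def frame_simps program_defs)
      have "prun N peel s2 (\<lambda>s3. matches s2 vs \<longrightarrow>
          (\<forall>i<m. narr s3 ''use'' i = of_bool (ed i \<in> path_edges vs)))"
        using d2 by (rule peel_correct) (use 2 m1 m2 in auto)
      then show "prun N (Seq peel walk) s2
        (\<lambda>s'. matches s vs \<longrightarrow> (\<forall>q<n. narr s' ''w'' q = vs ! q))"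
      proof (intro prun_Seq, elim prun_conseq)
        fix s3 assume f3: "frame peel s2 s3" and 3: "matches s2 vs \<longrightarrow>
          (\<forall>i<m. narr s3 ''use'' i = of_bool (ed i \<in> path_edges vs))"
        have d3: "data s3" using d2 f3 by (rule data_frame) (simp_all add: program_defs)
        have m3: "matches s3 vs \<longleftrightarrow> matches s vs"
          using f3 unfolding m2[symmetric] by (simp add: matches_def frame_simps program_defs)
        show "prun N walk s3 (\<lambda>s'. matches s vs \<longrightarrow> (\<forall>q<n. narr s' ''w'' q = vs ! q))"
          unfolding m3[symmetric]
          using d3 by (rule walk_correct) (use 3 m2 m3 in auto)
      qed
    qed
  qed
qed

end

section \<open>Checking a candidate\<close>

text \<open>Positions are stored shifted by one, so that zero means absence from the
  candidate.\<close>

definition mark_positions :: com where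
  "mark_positions = Seq (For ''i'' ''n'' (NStore ''idx'' var_i (Const 0)))
     (For ''i'' ''n'' (NStore ''idx'' (NArr ''w'' var_i) (Succ var_i)))"

definition check_cover :: com where
  "check_cover = For ''i'' ''n''
     (Cond (NEq (NArr ''idx'' var_i) (Const 0)) (NAssign ''ok'' (Const 0)) Skip)"

definition check_order :: com where
  "check_order = For ''q'' ''p''
     (Cond (NLess (NArr ''idx'' (NArr ''upper'' (NVar ''q''))) (NArr ''idx'' (NArr ''lower'' (NVar ''q''))))
       (NAssign ''ok'' (Const 0)) Skip)"

definition edge_hit :: com where
  "edge_hit = Seq (NAssign ''adj'' (Const 1))
     (RAssign ''cur'' (RAdd (RVar ''cur'') (RArr ''cost'' var_i)))"

definition edge_scan :: com where
  "edge_scan =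
     Cond (Conj (NEq src_i (NArr ''w'' (NVar ''q''))) (NEq dst_i (NArr ''w'' (Succ (NVar ''q'')))))
       edge_hit
       (Cond (Conj (NEq dst_i (NArr ''w'' (NVar ''q''))) (NEq src_i (NArr ''w'' (Succ (NVar ''q'')))))
         edge_hit Skip)"

definition check_edges :: com where
  "check_edges = For ''q'' ''len''
     (Seq (NAssign ''adj'' (Const 0))
     (Seq (For ''i'' ''m'' edge_scan)
          (Cond (NEq (NVar ''adj'') (Const 0)) (NAssign ''ok'' (Const 0)) Skip)))"

text \<open>The copy of the first vertex in position \<open>n\<close> makes the closing edge of a cycle one more
  consecutive pair.\<close>

definition check :: com where
  "check = Seq (NStore ''w'' (NVar ''n'') (NArr ''w'' (Const 0)))
     (Seq mark_positions
     (Seq (NAssign ''ok'' (Const 1))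
     (Seq check_cover
     (Seq check_order
     (Seq (RAssign ''cur'' RZero)
          check_edges)))))"

text \<open>Conditions have no disjunction; the negated conjunction says that nothing is stored yet
  or that the candidate is strictly cheaper.\<close>

definition update :: com where
  "update =
     Cond (Conj (NEq (NVar ''ok'') (Const 1))
            (Neg (Conj (NEq (NVar ''found'') (Const 1)) (Neg (RLess (RVar ''cur'') (RVar ''best''))))))
       (Seq (For ''i'' ''n'' (NStore ''out'' var_i (NArr ''w'' var_i)))
       (Seq (RAssign ''best'' (RVar ''cur''))
            (NAssign ''found'' (Const 1))))
       Skip"

definition try_ends :: com where
  "try_ends = For ''s'' ''n'' (For ''t'' ''n'' (Seq generate (Seq check update)))"

lemmas check_defs = mark_positions_def check_cover_def check_order_def edge_hit_def edge_scan_def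
  check_edges_def check_def update_def try_ends_def

context poh_instance
begin

definition problem :: "nat problem" where
  "problem = (if cyc then MinPOHCP else MinPOHPP)"

definition feas :: "nat list \<Rightarrow> bool" where
  "feas = feasible problem {..<n} E \<pi>"

definition tcost :: "nat list \<Rightarrow> real" where
  "tcost = total_cost problem c"

lemma feas_hamiltonian: "feas vs \<Longrightarrow> hamiltonian_path {..<n} E vs"
  by (auto simp: feas_def problem_def MinPOHPP_def MinPOHCP_def split: if_splits)

end

section \<open>Feasibility and cost of the sequence held in \<open>w\<close>\<close>

context spanned_instance
begin

definition len :: nat where "len = (if cyc then n else n - 1)"

text \<open>Pigeonhole principle on \<open>n\<close> positions and \<open>n\<close> vertices.
  Testing coverage thus also excludes repetitions and entries that are no vertices.\<close>

lemma cover_permutes: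
  fixes w :: "nat \<Rightarrow> nat"
  assumes "{..<n} \<subseteq> w ` {..<n}"
  shows "inj_on w {..<n}" "w ` {..<n} = {..<n}"
proof -
  show "inj_on w {..<n}" using assms by (intro finite_surj_inj) auto
  show "w ` {..<n} = {..<n}"
    using assms card_image_le[of "{..<n}" w] by (intro card_seteq[symmetric]) auto
qed

lemma hamiltonian_path_map:
  "hamiltonian_path {..<n} E (map w [0..<n]) \<longleftrightarrow>
     {..<n} \<subseteq> w ` {..<n} \<and> (\<forall>q<n - 1. {w q, w (Suc q)} \<in> E)"
proof -
  have "distinct (map w [0..<n]) \<and> set (map w [0..<n]) = {..<n} \<longleftrightarrow> {..<n} \<subseteq> w ` {..<n}"
  proof
    assume *: "{..<n} \<subseteq> w ` {..<n}"
    then show "distinct (map w [0..<n]) \<and> set (map w [0..<n]) = {..<n}"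
      using cover_permutes by (simp add: distinct_map atLeast0LessThan)
  qed (simp add: atLeast0LessThan)
  moreover have "(\<forall>i. Suc i < n \<longrightarrow> {w i, w (Suc i)} \<in> E) \<longleftrightarrow> (\<forall>q<n - 1. {w q, w (Suc q)} \<in> E)"
    by (auto simp: less_diff_conv)
  ultimately show ?thesis
    by (auto simp: hamiltonian_path_def)
qed

lemma feas_map:
  "feas (map w [0..<n]) \<longleftrightarrow> {..<n} \<subseteq> w ` {..<n} \<and> extending \<pi> (map w [0..<n]) \<and>
     (\<forall>q<len. {(w(n := w 0)) q, (w(n := w 0)) (Suc q)} \<in> E)"
proof -
  have ends: "hd (map w [0..<n]) = w 0" "last (map w [0..<n]) = w (n - 1)"
    using n_pos by (simp_all add: hd_map last_map)
  have "(\<forall>q<n - 1. {w q, w (Suc q)} \<in> E) \<longleftrightarrow>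
      (\<forall>q<n - 1. {(w(n := w 0)) q, (w(n := w 0)) (Suc q)} \<in> E)"
    by (intro all_cong) auto
  moreover have "(\<forall>q<n. {(w(n := w 0)) q, (w(n := w 0)) (Suc q)} \<in> E) \<longleftrightarrow>
      (\<forall>q<n - 1. {(w(n := w 0)) q, (w(n := w 0)) (Suc q)} \<in> E) \<and> {w 0, w (n - 1)} \<in> E"
  proof -
    obtain k where k: "n = Suc k" using n_pos gr0_implies_Suc by blast
    show ?thesis unfolding k All_less_Suc by (auto simp: insert_commute)
  qed
  ultimately show ?thesis
    using n_pos ends
    by (auto simp: feas_def problem_def MinPOHPP_def MinPOHCP_def hamiltonian_path_map len_def)
qed

lemma tcost_map:
  "tcost (map w [0..<n]) = (\<Sum>q<len. c {(w(n := w 0)) q, (w(n := w 0)) (Suc q)})"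
proof -
  have "path_cost c (map w [0..<n]) = (\<Sum>q<n - 1. c {(w(n := w 0)) q, (w(n := w 0)) (Suc q)})"
    by (auto simp: path_cost_def intro!: sum.cong)
  moreover have "(\<Sum>q<n. c {(w(n := w 0)) q, (w(n := w 0)) (Suc q)}) =
      (\<Sum>q<n - 1. c {(w(n := w 0)) q, (w(n := w 0)) (Suc q)}) + c {w (n - 1), w 0}"
  proof -
    obtain k where k: "n = Suc k" using n_pos gr0_implies_Suc by blast
    show ?thesis unfolding k sum.lessThan_Suc by simp
  qed
  ultimately show ?thesis
    using n_pos
    by (simp add: tcost_def problem_def MinPOHPP_def MinPOHCP_def cycle_cost_def len_def hd_map last_map)
qed

text \<open>On a covering sequence, \<open>idx\<close> is the inverse of \<open>w\<close> shifted by
  one, so the order can be tested with one comparison per listed pair.\<close>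

lemma extending_positions:
  assumes cover: "{..<n} \<subseteq> w ` {..<n}"
    and idx: "\<forall>v<n. idx v \<noteq> 0 \<and> idx v \<le> n \<and> w (idx v - 1) = v"
  shows "extending \<pi> (map w [0..<n]) \<longleftrightarrow>
    (\<forall>q<length ps. idx (fst (ps ! q)) \<le> idx (snd (ps ! q)))"
proof -
  note inj = cover_permutes(1)[OF cover] and eq = cover_permutes(2)[OF cover]
  have pos: "idx (w i) = Suc i" if "i < n" for i
  proof -
    have "w i < n" using that eq by blast
    then have *: "idx (w i) \<noteq> 0" "idx (w i) \<le> n" "w (idx (w i) - 1) = w i" using idx by blast+
    then have "idx (w i) - 1 < n" by linarith
    then have "idx (w i) - 1 = i" using inj_onD[OF inj *(3)] that by blast
    then show ?thesis using * by linarith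
  qed
  have sub: "a < n \<and> b < n" if "(a, b) \<in> \<pi>" for a b
    using that order by (auto simp: partial_order_on_def preorder_on_def)
  show ?thesis
  proof
    assume ext: "extending \<pi> (map w [0..<n])"
    show "\<forall>q<length ps. idx (fst (ps ! q)) \<le> idx (snd (ps ! q))"
    proof (intro allI impI)
      fix q assume "q < length ps"
      then have ab: "(fst (ps ! q), snd (ps ! q)) \<in> \<pi>" using set_ps by auto
      have "fst (ps ! q) \<in> w ` {..<n}" "snd (ps ! q) \<in> w ` {..<n}"
        using sub[OF ab] cover by blast+
      then obtain i j where ij: "i < n" "w i = fst (ps ! q)" "j < n" "w j = snd (ps ! q)"
        by (metis imageE lessThan_iff)
      then have "i \<le> j" using ext ab by (simp add: extending_def)
      then show "idx (fst (ps ! q)) \<le> idx (snd (ps ! q))" using pos[of i] pos[of j] ij by simp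
    qed
  next
    assume *: "\<forall>q<length ps. idx (fst (ps ! q)) \<le> idx (snd (ps ! q))"
    show "extending \<pi> (map w [0..<n])"
      unfolding extending_def
    proof (intro allI impI)
      fix i j assume i: "i < length (map w [0..<n])" and j: "j < length (map w [0..<n])"
        and p: "(map w [0..<n] ! i, map w [0..<n] ! j) \<in> \<pi>"
      then have "(w i, w j) \<in> set ps" using set_ps by simp
      then obtain q where "q < length ps" "ps ! q = (w i, w j)" by (auto simp: in_set_conv_nth)
      then have "idx (w i) \<le> idx (w j)" using * by force
      then show "i \<le> j" using pos i j by simp
    qed
  qed
qed

section \<open>Correctness of the checking programs\<close>

lemma data_simps:
  assumes "data s"
  shows "nvar s ''n'' = n" "nvar s ''m'' = m" "nvar s ''p'' = length ps" "nvar s ''len'' = len"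
    "i < m \<Longrightarrow> narr s ''src'' i = src i" "i < m \<Longrightarrow> narr s ''dst'' i = dst i"
    "i < m \<Longrightarrow> rarr s ''cost'' i = c (ed i)"
    "q < length ps \<Longrightarrow> narr s ''lower'' q = fst (ps ! q)"
    "q < length ps \<Longrightarrow> narr s ''upper'' q = snd (ps ! q)"
  using assms by (auto simp: data_def inp_def len_def)

lemma len_le: "len \<le> N" "m \<le> N"
  using bounds by (auto simp: len_def m_def)

text \<open>Here \<open>w\<close> is arbitrary: a vertex that occurs repeatedly ends up with its
  last position, and the statement only claims some position.\<close>

lemma mark_positions_correct:
  assumes data: "data s"
  shows "prun N mark_positions s (\<lambda>s'. \<forall>v<n.
    (narr s' ''idx'' v = 0 \<longleftrightarrow> v \<notin> narr s ''w'' ` {..<n}) \<and>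
    (narr s' ''idx'' v \<noteq> 0 \<longrightarrow> narr s' ''idx'' v \<le> n \<and> narr s ''w'' (narr s' ''idx'' v - 1) = v))"
proof -
  let ?C = "For ''i'' ''n'' (NStore ''idx'' var_i (Const 0))"
  define I where "I i s' \<longleftrightarrow> (\<forall>v<n.
    (narr s' ''idx'' v = 0 \<longleftrightarrow> v \<notin> narr s ''w'' ` {..<i}) \<and>
    (narr s' ''idx'' v \<noteq> 0 \<longrightarrow> narr s' ''idx'' v \<le> i \<and> narr s ''w'' (narr s' ''idx'' v - 1) = v))"
    for i and s' :: state
  have "prun N ?C s (\<lambda>s'. \<forall>v<n. narr s' ''idx'' v = 0)"
  proof (rule prun_For[where I = "\<lambda>i s'. \<forall>v<i. narr s' ''idx'' v = 0"])
    show "prun N (NStore ''idx'' var_i (Const 0)) s' (\<lambda>s'. \<forall>v<Suc i. narr s' ''idx'' v = 0)"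
      if "nvar s' ''i'' = i" "\<forall>v<i. narr s' ''idx'' v = 0" for i s'
      by (rule prun_step) (use that in \<open>auto simp: less_Suc_eq\<close>)
  qed (use data_simps(1)[OF data] bounds in auto)
  then show ?thesis
    unfolding mark_positions_def
  proof (intro prun_Seq, elim prun_conseq)
    fix s1 assume f1: "frame ?C s s1" and zero: "\<forall>v<n. narr s1 ''idx'' v = 0"
    have d1: "data s1" using data f1 by (rule data_frame) simp_all
    have w1: "narr s1 ''w'' = narr s ''w''" using f1 by (simp add: frame_narr)
    show "prun N (For ''i'' ''n'' (NStore ''idx'' (NArr ''w'' var_i) (Succ var_i))) s1 (\<lambda>s'. \<forall>v<n.
      (narr s' ''idx'' v = 0 \<longleftrightarrow> v \<notin> narr s ''w'' ` {..<n}) \<and>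
      (narr s' ''idx'' v \<noteq> 0 \<longrightarrow> narr s' ''idx'' v \<le> n \<and> narr s ''w'' (narr s' ''idx'' v - 1) = v))"
    proof (rule prun_For[where I = I], goal_cases)
      case (7 i s')
      have w: "narr s' ''w'' = narr s ''w''" using 7(3) w1 by (simp add: frame_narr)
      show ?case
        by (rule prun_step) (use 7(2,4) w in \<open>auto simp: I_def lessThan_Suc\<close>)
    qed (use data_simps(1)[OF d1] bounds zero in \<open>auto simp: I_def\<close>)
  qed
qed

lemma check_cover_correct:
  assumes data: "data s"
  shows "prun N check_cover s (\<lambda>s'. nvar s' ''ok'' = 1 \<longleftrightarrow>
    nvar s ''ok'' = 1 \<and> (\<forall>v<n. narr s ''idx'' v \<noteq> 0))"
  unfolding check_cover_def
proof (rule prun_For[where I = "\<lambda>i s'. nvar s' ''ok'' = 1 \<longleftrightarrow>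
    nvar s ''ok'' = 1 \<and> (\<forall>v<i. narr s ''idx'' v \<noteq> 0)"], goal_cases)
  case (7 i s')
  have "narr s' ''idx'' = narr s ''idx''" using 7(3) by (simp add: frame_narr)
  then show ?case
    by (intro prun_step) (use 7(2,4) in \<open>auto simp: less_Suc_eq\<close>)
qed (use data_simps(1)[OF data] bounds in auto)

lemma check_order_correct:
  assumes data: "data s"
  shows "prun N check_order s (\<lambda>s'. nvar s' ''ok'' = 1 \<longleftrightarrow> nvar s ''ok'' = 1 \<and>
    (\<forall>q<length ps. narr s ''idx'' (fst (ps ! q)) \<le> narr s ''idx'' (snd (ps ! q))))"
  unfolding check_order_def
proof (rule prun_For[where I = "\<lambda>i s'. nvar s' ''ok'' = 1 \<longleftrightarrow> nvar s ''ok'' = 1 \<and>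
    (\<forall>q<i. narr s ''idx'' (fst (ps ! q)) \<le> narr s ''idx'' (snd (ps ! q)))"], goal_cases)
  case (7 i s')
  have i: "i < length ps" using 7(1) data_simps(3)[OF data] by simp
  have "data s'" using data 7(3) by (rule data_frame) simp_all
  note data_simps(8,9)[OF this i]
  moreover have "narr s' ''idx'' = narr s ''idx''" using 7(3) by (simp add: frame_narr)
  ultimately show ?case
    by (intro prun_step) (use 7(2,4) in \<open>auto simp: less_Suc_eq\<close>)
qed (use data_simps(3)[OF data] bounds in auto)

lemma edge_scan_correct:
  assumes data: "data s" and q: "nvar s ''q'' = q" and adj: "nvar s ''adj'' = 0"
    and e: "{narr s ''w'' q, narr s ''w'' (Suc q)} = e"
  shows "prun N (For ''i'' ''m'' edge_scan) s (\<lambda>s'.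
    (nvar s' ''adj'' = 0 \<longleftrightarrow> e \<notin> E) \<and> (e \<in> E \<longrightarrow> rvar s' ''cur'' = rvar s ''cur'' + c e))"
proof -
  define I where "I i s' \<longleftrightarrow> (nvar s' ''adj'' = 0 \<longleftrightarrow> (\<forall>i'<i. ed i' \<noteq> e)) \<and>
    rvar s' ''cur'' = rvar s ''cur'' + (if \<exists>i'<i. ed i' = e then c e else 0)"
    for i and s' :: state
  show ?thesis
  proof (rule prun_For[where I = I], goal_cases)
    case (7 i s')
    have i: "i < m" using 7(1) data_simps(2)[OF data] by simp
    have "data s'" using data 7(3) by (rule data_frame) (simp_all add: check_defs)
    note d = data_simps(5-7)[OF this i]
    have w: "narr s' ''w'' = narr s ''w''" "nvar s' ''q'' = q"
      using 7(3) q by (simp_all add: frame_simps check_defs)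
    have hit: "ed i = e \<longleftrightarrow> src i = narr s ''w'' q \<and> dst i = narr s ''w'' (Suc q) \<or>
        dst i = narr s ''w'' q \<and> src i = narr s ''w'' (Suc q)"
      unfolding e[symmetric] ed_def by (auto simp: doubleton_eq_iff)
    have I: "I i s'" by (fact 7(4))
    have "I (Suc i) (step edge_scan s')"
    proof (cases "ed i = e")
      case True
      then have "step edge_scan s' = step edge_hit s'"
        using hit d(1,2) w 7(2) by (auto simp: edge_scan_def)
      \<comment> \<open>Different indices carry different edges, so the cost is added only once per
        pair.\<close>
      moreover have "\<not> (\<exists>i'<i. ed i' = e)"
        using True ed_eq i by (metis less_irrefl less_trans)
      ultimately show ?thesis
        using I True d(3) 7(2) by (auto simp: I_def edge_hit_def)
    next
      case False
      then have "step edge_scan s' = s'"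
        using hit d(1,2) w 7(2) by (auto simp: edge_scan_def)
      then show ?thesis using I False by (auto simp: I_def less_Suc_eq)
    qed
    then show ?case by (intro prun_step) (simp_all add: check_defs)
  next
    case (8 s')
    have "e \<in> E \<longleftrightarrow> (\<exists>i<m. ed i = e)" using E_eq by auto
    then show ?case using 8 data_simps(2)[OF data] by (auto simp: I_def)
  qed (use data_simps(2)[OF data] len_le adj in \<open>auto simp: I_def check_defs\<close>)
qed

text \<open>The value of \<open>cur\<close> is claimed only if \<open>ok\<close> is set, since a
  missing edge adds nothing to it.\<close>

lemma check_edges_correct:
  assumes data: "data s" and cur: "rvar s ''cur'' = 0"
    and w: "w = narr s ''w''"
  shows "prun N check_edges s (\<lambda>s'.
    (nvar s' ''ok'' = 1 \<longleftrightarrow> nvar s ''ok'' = 1 \<and> (\<forall>q<len. {w q, w (Suc q)} \<in> E)) \<and>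
    (nvar s' ''ok'' = 1 \<longrightarrow> rvar s' ''cur'' = (\<Sum>q<len. c {w q, w (Suc q)})))"
proof -
  define I where "I i s' \<longleftrightarrow>
    (nvar s' ''ok'' = 1 \<longleftrightarrow> nvar s ''ok'' = 1 \<and> (\<forall>q<i. {w q, w (Suc q)} \<in> E)) \<and>
    (nvar s' ''ok'' = 1 \<longrightarrow> rvar s' ''cur'' = (\<Sum>q<i. c {w q, w (Suc q)}))"
    for i and s' :: state
  show ?thesis
    unfolding check_edges_def
  proof (rule prun_For[where I = I], goal_cases)
    case (7 q s')
    let ?s = "step (NAssign ''adj'' (Const 0)) s'"
    let ?e = "{w q, w (Suc q)}"
    have "data s'" using data 7(3) by (rule data_frame) (simp_all add: check_defs)
    then have d: "data ?s" by (simp add: data_def inp_def)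
    have w': "narr s' ''w'' = w" using 7(3) w by (simp add: frame_simps check_defs)
    have "prun N (For ''i'' ''m'' edge_scan) ?s (\<lambda>s''.
      (nvar s'' ''adj'' = 0 \<longleftrightarrow> ?e \<notin> E) \<and> (?e \<in> E \<longrightarrow> rvar s'' ''cur'' = rvar ?s ''cur'' + c ?e))"
      using d by (rule edge_scan_correct) (use 7(2) w' in simp_all)
    then show ?case
    proof (intro prun_step_Seq prun_Seq, simp, elim prun_conseq, intro prun_step)
      fix s'' assume f: "frame (For ''i'' ''m'' edge_scan) ?s s''"
        and s'': "(nvar s'' ''adj'' = 0 \<longleftrightarrow> ?e \<notin> E) \<and>
          (?e \<in> E \<longrightarrow> rvar s'' ''cur'' = rvar ?s ''cur'' + c ?e)"
      have "nvar s'' ''ok'' = nvar s' ''ok''" using f by (simp add: frame_simps check_defs)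
      then show "I (Suc q) (step (Cond (NEq (NVar ''adj'') (Const 0)) (NAssign ''ok'' (Const 0)) Skip) s'')"
        using s'' 7(4) by (auto simp: I_def less_Suc_eq)
    qed simp
  qed (use data_simps(4)[OF data] len_le cur in \<open>auto simp: I_def check_defs\<close>)
qed

text \<open>Nothing is assumed about the contents of \<open>w\<close>: acceptance is exact however
  the sequence arose. The soundness of the whole program rests on this.\<close>

lemma check_correct:
  assumes data: "data s"
  shows "prun N check s (\<lambda>s'. (\<forall>i<n. narr s' ''w'' i = narr s ''w'' i) \<and>
    (nvar s' ''ok'' = 1 \<longleftrightarrow> feas (map (narr s' ''w'') [0..<n])) \<and>
    (nvar s' ''ok'' = 1 \<longrightarrow> rvar s' ''cur'' = tcost (map (narr s' ''w'') [0..<n])))"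
    (is "prun N check s ?R")
proof -
  define w where "w = (narr s ''w'')(n := narr s ''w'' 0)"
  have w_map: "map w [0..<n] = map (narr s ''w'') [0..<n]" by (simp add: w_def)
  have w_n: "w n = w 0" by (simp add: w_def)
  let ?s = "step (NStore ''w'' (NVar ''n'') (NArr ''w'' (Const 0))) s"
  have d: "data ?s" using data by (simp add: data_def inp_def)
  have ws: "narr ?s ''w'' = w" using data_simps(1)[OF data] by (simp add: w_def)
  show ?thesis
    unfolding check_def
  proof (rule prun_step_Seq, simp, rule prun_Seq, rule prun_conseq[OF mark_positions_correct[OF d]])
    fix s1 assume f1: "frame mark_positions ?s s1"
      and 1: "\<forall>v<n. (narr s1 ''idx'' v = 0 \<longleftrightarrow> v \<notin> narr ?s ''w'' ` {..<n}) \<and>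
        (narr s1 ''idx'' v \<noteq> 0 \<longrightarrow> narr s1 ''idx'' v \<le> n \<and> narr ?s ''w'' (narr s1 ''idx'' v - 1) = v)"
    let ?s1 = "step (NAssign ''ok'' (Const 1)) s1"
    define idx where "idx = narr s1 ''idx''"
    have "data s1" using d f1 by (rule data_frame) (simp_all add: check_defs)
    then have d1: "data ?s1" by (simp add: data_def inp_def)
    have w1: "narr ?s1 ''w'' = w" using f1 ws by (simp add: frame_simps check_defs)
    have idx: "idx v = 0 \<longleftrightarrow> v \<notin> w ` {..<n}" "idx v \<noteq> 0 \<Longrightarrow> idx v \<le> n \<and> w (idx v - 1) = v"
      if "v < n" for v
      using 1 that unfolding ws idx_def by auto
    show "prun N (Seq (NAssign ''ok'' (Const 1)) (Seq check_cover (Seq check_order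
      (Seq (RAssign ''cur'' RZero) check_edges)))) s1 ?R"
    proof (rule prun_step_Seq, simp, rule prun_Seq, rule prun_conseq[OF check_cover_correct[OF d1]])
      fix s2 assume f2: "frame check_cover ?s1 s2" and 2: "nvar s2 ''ok'' = 1 \<longleftrightarrow>
        nvar ?s1 ''ok'' = 1 \<and> (\<forall>v<n. narr ?s1 ''idx'' v \<noteq> 0)"
      have d2: "data s2" using d1 f2 by (rule data_frame) (simp_all add: check_defs)
      have w2: "narr s2 ''w'' = w" "narr s2 ''idx'' = idx"
        using f2 w1 idx_def by (simp_all add: frame_simps check_defs)
      show "prun N (Seq check_order (Seq (RAssign ''cur'' RZero) check_edges)) s2 ?R"
      proof (rule prun_Seq, rule prun_conseq[OF check_order_correct[OF d2]])
        fix s3 assume f3: "frame check_order s2 s3" and 3: "nvar s3 ''ok'' = 1 \<longleftrightarrow> nvar s2 ''ok'' = 1 \<and>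
          (\<forall>q<length ps. narr s2 ''idx'' (fst (ps ! q)) \<le> narr s2 ''idx'' (snd (ps ! q)))"
        let ?s3 = "step (RAssign ''cur'' RZero) s3"
        have "data s3" using d2 f3 by (rule data_frame) (simp_all add: check_defs)
        then have d3: "data ?s3" by (simp add: data_def inp_def)
        have w3: "w = narr ?s3 ''w''" using f3 w2 by (simp add: frame_simps check_defs)
        show "prun N (Seq (RAssign ''cur'' RZero) check_edges) s3 ?R"
        proof (rule prun_step_Seq, simp, rule prun_conseq[OF check_edges_correct[OF d3 _ w3]])
          fix s4 assume f4: "frame check_edges ?s3 s4"
            and 4: "(nvar s4 ''ok'' = 1 \<longleftrightarrow> nvar ?s3 ''ok'' = 1 \<and> (\<forall>q<len. {w q, w (Suc q)} \<in> E)) \<and>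
              (nvar s4 ''ok'' = 1 \<longrightarrow> rvar s4 ''cur'' = (\<Sum>q<len. c {w q, w (Suc q)}))"
          have w4: "narr s4 ''w'' = w" using f4 w3 by (simp add: frame_simps check_defs)
          have cover: "(\<forall>v<n. idx v \<noteq> 0) \<longleftrightarrow> {..<n} \<subseteq> w ` {..<n}"
            using idx(1) by auto
          have "extending \<pi> (map w [0..<n]) \<longleftrightarrow>
              (\<forall>q<length ps. idx (fst (ps ! q)) \<le> idx (snd (ps ! q)))"
            if "{..<n} \<subseteq> w ` {..<n}"
            by (rule extending_positions[OF that]) (use that cover idx(2) in auto)
          \<comment> \<open>Cell \<open>n\<close> already repeats cell 0, so the update in
            \<open>feas_map\<close> and \<open>tcost_map\<close> changes nothing.\<close>
          moreover have "w(n := w 0) = w" using w_n by (simp add: fun_upd_idem)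
          ultimately have "nvar s4 ''ok'' = 1 \<longleftrightarrow> feas (map w [0..<n])"
            using 2 3 4 cover idx_def w2 by (auto simp: feas_map)
          moreover have "tcost (map w [0..<n]) = (\<Sum>q<len. c {w q, w (Suc q)})"
            using tcost_map[of w] \<open>w(n := w 0) = w\<close> by simp
          ultimately show "?R s4"
            using 4 w4 by (simp add: w_def)
        qed simp
      qed
    qed
  qed
qed

section \<open>Keeping the best candidate\<close>

text \<open>\<open>C\<close> describes the sequences already accounted for, and progress means
  enlarging it. The stored sequence is feasible and no worse than any feasible one in
  \<open>C\<close>; at the end \<open>C\<close> holds everywhere.\<close>

definition best_of :: "(nat list \<Rightarrow> bool) \<Rightarrow> state \<Rightarrow> bool" where
  "best_of C s \<longleftrightarrow> (nvar s ''found'' = 0 \<or> nvar s ''found'' = 1) \<and>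
     (nvar s ''found'' = 1 \<longrightarrow> feas (map (narr s ''out'') [0..<n]) \<and>
        rvar s ''best'' = tcost (map (narr s ''out'') [0..<n])) \<and>
     (\<forall>vs. feas vs \<and> C vs \<longrightarrow> nvar s ''found'' = 1 \<and> rvar s ''best'' \<le> tcost vs)"

lemma best_of_frame:
  assumes "best_of C s" "frame P s s'" "''found'' \<notin> nvar_writes P" "''out'' \<notin> narr_writes P"
    "''best'' \<notin> rvar_writes P"
  shows "best_of C s'"
proof -
  have eq: "nvar s' ''found'' = nvar s ''found''" "narr s' ''out'' = narr s ''out''"
    "rvar s' ''best'' = rvar s ''best''"
    using assms by (simp_all add: frame_simps)
  show ?thesis using assms(1) unfolding best_of_def eq .
qed

text \<open>Provides the premise \<open>indep\<close> of \<open>prun_For\<close> for the loops over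
  both ends.\<close>

lemma best_of_nvar:
  "x \<noteq> ''found'' \<Longrightarrow> best_of C (s\<lparr>nvar := (nvar s)(x := k)\<rparr>) \<longleftrightarrow> best_of C s"
  by (simp add: best_of_def cong: conj_cong)

lemma best_of_mono: "best_of C s \<Longrightarrow> (\<And>vs. feas vs \<Longrightarrow> D vs \<Longrightarrow> C vs) \<Longrightarrow> best_of D s"
  unfolding best_of_def by blast

lemma update_correct:
  assumes data: "data s" and best: "best_of C s"
    and ok: "nvar s ''ok'' = 1 \<longleftrightarrow> feas (map (narr s ''w'') [0..<n])"
    and cur: "nvar s ''ok'' = 1 \<Longrightarrow> rvar s ''cur'' = tcost (map (narr s ''w'') [0..<n])"
    and D: "\<And>vs. feas vs \<Longrightarrow> D vs \<Longrightarrow> C vs \<or> vs = map (narr s ''w'') [0..<n]"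
  shows "prun N update s (best_of D)"
  unfolding update_def
proof (rule prun_Cond, goal_cases)
  case 1
  let ?C = "For ''i'' ''n'' (NStore ''out'' var_i (NArr ''w'' var_i))"
  have "prun N ?C s (\<lambda>s'. \<forall>i<n. narr s' ''out'' i = narr s ''w'' i)"
  proof (rule prun_For[where I = "\<lambda>i s'. \<forall>v<i. narr s' ''out'' v = narr s ''w'' v"], goal_cases)
    case (7 i s')
    have "narr s' ''w'' = narr s ''w''" using 7(3) by (simp add: frame_simps)
    then show ?case
      by (intro prun_step) (use 7(2,4) in \<open>auto simp: less_Suc_eq\<close>)
  qed (use data_simps(1)[OF data] bounds in auto)
  then show ?case
  proof (intro prun_Seq, elim prun_conseq, intro prun_step_Seq prun_step)
    fix s' assume f: "frame ?C s s'" and out: "\<forall>i<n. narr s' ''out'' i = narr s ''w'' i"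
    have out: "map (narr s' ''out'') [0..<n] = map (narr s ''w'') [0..<n]"
      using out by simp
    have "rvar s' ''cur'' = rvar s ''cur''" using f by (simp add: frame_simps)
    moreover have "tcost (map (narr s ''w'') [0..<n]) \<le> tcost vs" if "feas vs" "D vs" for vs
      using D[OF that] that best cur 1 unfolding best_of_def by fastforce
    ultimately show "best_of D (step (NAssign ''found'' (Const 1)) (step (RAssign ''best'' (RVar ''cur'')) s'))"
      using ok cur 1 by (simp add: best_of_def out del: map_eq_conv)
  qed simp_all
next
  case 2
  \<comment> \<open>Either the candidate is infeasible, or a sequence that costs no more is already
    stored.\<close>
  have "nvar s ''found'' = 1 \<and> rvar s ''best'' \<le> tcost vs" if "feas vs" "D vs" for vs
    using D[OF that] that best ok cur 2 unfolding best_of_def by fastforce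
  then show ?case
    using best by (intro prun_step) (auto simp: best_of_def)
qed

definition selected :: "state \<Rightarrow> nat list \<Rightarrow> bool" where
  "selected s vs \<longleftrightarrow> (\<forall>i<m. \<not> in_tree i \<longrightarrow> narr s ''sel'' i = of_bool (ed i \<in> path_edges vs))"

text \<open>Soundness comes from the exact check, completeness from the generator: a feasible path
  with the current ends and choice is reproduced in \<open>w\<close> and then compared with the best
  one.\<close>

lemma try_correct:
  assumes data: "data s" and best: "best_of C s"
    and st: "nvar s ''s'' < n" "nvar s ''t'' < n"
    and D: "\<And>vs. feas vs \<Longrightarrow> D vs \<Longrightarrow>
      C vs \<or> hd vs = nvar s ''s'' \<and> last vs = nvar s ''t'' \<and> selected s vs"
  shows "prun N (Seq generate (Seq check update)) s (best_of D)"
proof (rule prun_Seq, rule prun_conseq[OF generate_correct[OF data st]])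
  fix s1 assume f1: "frame generate s s1"
    and 1: "\<forall>vs. matches s vs \<longrightarrow> (\<forall>q<n. narr s1 ''w'' q = vs ! q)"
  have d1: "data s1" using data f1 by (rule data_frame) (simp_all add: program_defs)
  have b1: "best_of C s1" using best f1 by (rule best_of_frame) (simp_all add: program_defs)
  show "prun N (Seq check update) s1 (best_of D)"
  proof (rule prun_Seq, rule prun_conseq[OF check_correct[OF d1]])
    fix s2 assume f2: "frame check s1 s2"
      and 2: "(\<forall>i<n. narr s2 ''w'' i = narr s1 ''w'' i) \<and>
        (nvar s2 ''ok'' = 1 \<longleftrightarrow> feas (map (narr s2 ''w'') [0..<n])) \<and>
        (nvar s2 ''ok'' = 1 \<longrightarrow> rvar s2 ''cur'' = tcost (map (narr s2 ''w'') [0..<n]))"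
    have d2: "data s2" using d1 f2 by (rule data_frame) (simp_all add: check_defs)
    have b2: "best_of C s2" using b1 f2 by (rule best_of_frame) (simp_all add: check_defs)
    show "prun N update s2 (best_of D)"
      using d2 b2
    proof (rule update_correct)
      fix vs assume vs: "feas vs" "D vs"
      show "C vs \<or> vs = map (narr s2 ''w'') [0..<n]"
      proof (cases "C vs")
        case False
        have hp: "hamiltonian_path {..<n} E vs" using vs(1) by (rule feas_hamiltonian)
        then have "matches s vs"
          using D[OF vs] False by (simp add: matches_def selected_def)
        then have "\<forall>q<n. narr s2 ''w'' q = vs ! q" using 1 2 by simp
        then have "vs = map (narr s2 ''w'') [0..<n]"
          using hamiltonian_path_length[OF hp] by (intro nth_equalityI) auto
        then show ?thesis by blast
      qed simp
    qed (use 2 in auto)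
  qed
qed

lemma try_ends_correct:
  assumes data: "data s" and best: "best_of C s"
    and D: "\<And>vs. feas vs \<Longrightarrow> D vs \<Longrightarrow> C vs \<or> selected s vs"
  shows "prun N try_ends s (best_of D)"
proof -
  have ends: "hd vs < n" "last vs < n" if "feas vs" for vs
  proof -
    have "hamiltonian_path {..<n} E vs" using that by (rule feas_hamiltonian)
    then have "vs \<noteq> []" "set vs = {..<n}" using n_pos by (auto simp: hamiltonian_path_def)
    then show "hd vs < n" "last vs < n" using hd_in_set last_in_set by blast+
  qed
  \<comment> \<open>The pairs of ends are exhausted lexicographically: \<open>I\<close> covers first
    vertices below \<open>i\<close>, and \<open>J\<close> in addition first vertex \<open>i\<close>
    with last vertices below \<open>j\<close>.\<close>
  define I where "I i s' \<longleftrightarrow> best_of (\<lambda>vs. C vs \<or> selected s vs \<and> hd vs < i) s'" for i s'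
  define J where "J i j s' \<longleftrightarrow>
    best_of (\<lambda>vs. C vs \<or> selected s vs \<and> (hd vs < i \<or> hd vs = i \<and> last vs < j)) s'" for i j s'
  show ?thesis
    unfolding try_ends_def
  proof (rule prun_For[where I = I], goal_cases)
    case (7 i s1)
    have i: "i < n" using 7(1) data_simps(1)[OF data] by simp
    have d1: "data s1"
      using data 7(3) by (rule data_frame) (simp_all add: program_defs check_defs)
    show ?case
    proof (rule prun_For[where I = "J i"], goal_cases)
      case inner: (7 j s2)
      have j: "j < n" using inner(1) data_simps(1)[OF d1] by simp
      have d2: "data s2"
        using d1 inner(3) by (rule data_frame) (simp_all add: program_defs check_defs)
      have si: "nvar s2 ''s'' = i"
        using inner(3) 7(2) by (simp add: frame_simps program_defs check_defs)
      have "narr s2 ''sel'' = narr s ''sel''"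
        using inner(3) 7(3) by (simp add: frame_simps program_defs check_defs)
      then have sel: "selected s2 vs \<longleftrightarrow> selected s vs" for vs by (simp add: selected_def)
      show ?case
        unfolding J_def
        by (rule try_correct[OF d2 inner(4)[unfolded J_def]])
           (use i j si inner(2) sel in \<open>auto simp: less_Suc_eq\<close>)
    next
      case 5
      show ?case using 7(4) unfolding I_def J_def by (rule best_of_mono) auto
    next
      case (8 s2)
      then have "J i n s2" using data_simps(1)[OF d1] by simp
      then show ?case
        unfolding I_def J_def by (rule best_of_mono) (use ends in \<open>auto simp: less_Suc_eq\<close>)
    next
      case (6 j k s2)
      then show ?case by (simp add: J_def best_of_nvar)
    qed (use data_simps(1)[OF d1] bounds in \<open>auto simp: program_defs check_defs\<close>)
  next
    case 5
    show ?case using best unfolding I_def by (rule best_of_mono) auto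
  next
    case (8 s')
    then have "I n s'" using data_simps(1)[OF data] by simp
    then show ?case
      unfolding I_def by (rule best_of_mono) (use D ends in auto)
  next
    case (6 j k s2)
    then show ?case by (simp add: I_def best_of_nvar)
  qed (use data_simps(1)[OF data] bounds in \<open>auto simp: program_defs check_defs\<close>)
qed

end

section \<open>Enumerating the chosen non-tree edges\<close>

text \<open>Ripple-carry addition of one on the positions outside of the tree. A carry left over
  after the last position signals that all choices have been tried.\<close>

definition increment :: com where
  "increment = Seq (NAssign ''carry'' (Const 1))
     (For ''i'' ''m''
       (Cond (Conj (NEq (NArr ''tree'' var_i) (Const 0)) (NEq (NVar ''carry'') (Const 1)))
         (Cond (NEq (NArr ''sel'' var_i) (Const 0))
           (Seq (NStore ''sel'' var_i (Const 1)) (NAssign ''carry'' (Const 0)))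
           (NStore ''sel'' var_i (Const 0)))
         Skip))"

definition enumerate_choices :: com where
  "enumerate_choices = Loop (NEq (NVar ''carry'') (Const 0)) (Seq try_ends increment)"

text \<open>For \<open>n = 0\<close> the empty sequence is a Hamiltonian path, but a cycle has to be
  nonempty. If the tree does not span, \<open>found\<close> keeps its initial value zero.\<close>

definition solve :: "bool \<Rightarrow> com" where
  "solve cyc = Cond (NEq (NVar ''n'') (Const 0))
     (NAssign ''found'' (Const (if cyc then 0 else 1)))
     (Seq grow_tree
       (Cond (NEq (NVar ''slot'') (Const 0))
         (Seq (NAssign ''l'' (Pred (NVar ''n'')))
         (Seq (NAssign ''len'' (if cyc then NVar ''n'' else Pred (NVar ''n'')))
              enumerate_choices))
         Skip))"

context spanned_instance
begin

abbreviation "cval f \<equiv> counter_val in_tree f m"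

abbreviation "cmax \<equiv> 2 ^ digits in_tree m"

definition binary :: "(nat \<Rightarrow> nat) \<Rightarrow> bool" where
  "binary f \<longleftrightarrow> (\<forall>i<m. \<not> in_tree i \<longrightarrow> f i \<le> 1)"

lemma increment_correct:
  assumes data: "data s" and bin: "binary (narr s ''sel'')"
  shows "prun N increment s (\<lambda>s'. binary (narr s' ''sel'') \<and>
    (nvar s' ''carry'' = 0 \<or> nvar s' ''carry'' = 1) \<and>
    cval (narr s' ''sel'') + nvar s' ''carry'' * cmax = cval (narr s ''sel'') + 1)"
proof -
  \<comment> \<open>The final equation, truncated at position \<open>i\<close>; the cells from
    \<open>i\<close> on are still untouched.\<close>
  define I where "I i s' \<longleftrightarrow> binary (narr s' ''sel'') \<and>
    (nvar s' ''carry'' = 0 \<or> nvar s' ''carry'' = 1) \<and>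
    (\<forall>i'\<ge>i. narr s' ''sel'' i' = narr s ''sel'' i') \<and>
    counter_val in_tree (narr s' ''sel'') i + nvar s' ''carry'' * 2 ^ digits in_tree i
      = counter_val in_tree (narr s ''sel'') i + 1" for i and s' :: state
  have d: "data (step (NAssign ''carry'' (Const 1)) s)"
    using data by (simp add: data_def inp_def)
  show ?thesis
    unfolding increment_def
  proof (rule prun_step_Seq, simp, rule prun_For[where I = I], goal_cases)
    case (7 i s')
    have i: "i < m" using 7(1) data_simps(2)[OF d] by simp
    have d': "data s'" using d 7(3) by (rule data_frame) simp_all
    have tree: "narr s' ''tree'' i = of_bool (in_tree i)" using d' i by (simp add: data_def)
    have I: "I i s'" by (fact 7(4))
    then have bin: "\<not> in_tree i \<Longrightarrow> narr s' ''sel'' i \<le> 1"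
      using i unfolding I_def binary_def by blast
    have same: "narr s ''sel'' i = narr s' ''sel'' i" using I by (simp add: I_def)
    have upd: "counter_val in_tree ((narr s' ''sel'')(i := x)) i = counter_val in_tree (narr s' ''sel'') i"
      for x by (rule counter_val_cong) simp
    have bin': "binary ((narr s' ''sel'')(i := x))" if "x \<le> 1" for x
      using I that by (simp add: I_def binary_def)
    show ?case
    proof (rule prun_step)
      consider "in_tree i" | "\<not> in_tree i" "nvar s' ''carry'' = 0" |
        "\<not> in_tree i" "nvar s' ''carry'' = 1" "narr s' ''sel'' i = 0" |
        "\<not> in_tree i" "nvar s' ''carry'' = 1" "narr s' ''sel'' i = 1"
        using I bin unfolding I_def by (metis le_neq_implies_less less_one)
      then show "I (Suc i) (step (Cond (Conj (NEq (NArr ''tree'' var_i) (Const 0)) (NEq (NVar ''carry'') (Const 1)))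
         (Cond (NEq (NArr ''sel'' var_i) (Const 0))
           (Seq (NStore ''sel'' var_i (Const 1)) (NAssign ''carry'' (Const 0)))
           (NStore ''sel'' var_i (Const 0))) Skip) s')"
        using I tree 7(2) same upd bin' by cases (auto simp: I_def)
    qed simp
  next
    case (8 s')
    then show ?case using data_simps(2)[OF d] by (simp add: I_def)
  qed (use data_simps(2)[OF d] len_le bin in \<open>auto simp: I_def\<close>)
qed

text \<open>The value of the counter in the round in which \<open>vs\<close> is accounted
  for.\<close>

definition choice_code :: "nat list \<Rightarrow> nat" where
  "choice_code vs = cval (\<lambda>i. of_bool (ed i \<in> path_edges vs))"

lemma choice_code_less: "choice_code vs < cmax"
  unfolding choice_code_def by (rule counter_val_less) auto

lemma choice_code_selected:
  assumes "binary (narr s ''sel'')" "choice_code vs = cval (narr s ''sel'')"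
  shows "selected s vs"
  unfolding selected_def
proof (intro allI impI)
  fix i assume "i < m" "\<not> in_tree i"
  then show "narr s ''sel'' i = of_bool (ed i \<in> path_edges vs)"
    using assms counter_val_inject[of m in_tree "narr s ''sel''" "\<lambda>i. of_bool (ed i \<in> path_edges vs)" i]
    unfolding binary_def choice_code_def by auto
qed

text \<open>Before overflow, the counter equals the number \<open>k\<close> of completed rounds and
  all paths with a smaller code are covered; this also bounds the number of rounds by
  \<open>cmax\<close>.\<close>

lemma enumerate_choices_correct:
  assumes data: "data s" and carry: "nvar s ''carry'' = 0" and found: "nvar s ''found'' = 0"
    and sel: "narr s ''sel'' = (\<lambda>_. 0)"
  shows "run (cmax * (ptime N (Seq try_ends increment) + 1) + 1) enumerate_choices s (best_of (\<lambda>_. True))"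
proof -
  define I where "I k s' \<longleftrightarrow> data s' \<and> binary (narr s' ''sel'') \<and>
    (nvar s' ''carry'' = 0 \<and> cval (narr s' ''sel'') = k \<and> best_of (\<lambda>vs. choice_code vs < k) s' \<or>
     nvar s' ''carry'' = 1 \<and> best_of (\<lambda>_. True) s')" for k s'
  show ?thesis
    unfolding enumerate_choices_def
  proof (rule run_Loop[where I = I])
    fix k s1 assume I: "I k s1" and b: "bval (NEq (NVar ''carry'') (Const 0)) s1"
    then have 1: "data s1" "binary (narr s1 ''sel'')" "cval (narr s1 ''sel'') = k"
      "best_of (\<lambda>vs. choice_code vs < k) s1"
      by (auto simp: I_def)
    have "k < cmax"
      using 1(2,3) counter_val_less[of m in_tree "narr s1 ''sel''"] by (simp add: binary_def)
    moreover have "prun N (Seq try_ends increment) s1 (I (Suc k))"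
    proof (rule prun_Seq, rule prun_conseq[OF try_ends_correct[OF 1(1,4)]])
      show "choice_code vs < k \<or> selected s1 vs" if "feas vs" "choice_code vs < Suc k" for vs
        using that(2) choice_code_selected[OF 1(2), of vs] 1(3) by (auto simp: less_Suc_eq)
      fix s2 assume f2: "frame try_ends s1 s2" and best2: "best_of (\<lambda>vs. choice_code vs < Suc k) s2"
      have d2: "data s2"
        using 1(1) f2 by (rule data_frame) (simp_all add: program_defs check_defs)
      have sel: "narr s2 ''sel'' = narr s1 ''sel''"
        using f2 by (simp add: frame_simps program_defs check_defs)
      have bin2: "binary (narr s2 ''sel'')" using 1(2) sel by simp
      show "prun N increment s2 (I (Suc k))"
      proof (rule prun_conseq[OF increment_correct[OF d2 bin2]])
        fix s3 assume f3: "frame increment s2 s3" and 3: "binary (narr s3 ''sel'') \<and>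
          (nvar s3 ''carry'' = 0 \<or> nvar s3 ''carry'' = 1) \<and>
          cval (narr s3 ''sel'') + nvar s3 ''carry'' * cmax = cval (narr s2 ''sel'') + 1"
        have d3: "data s3" using d2 f3 by (rule data_frame) (simp_all add: increment_def)
        have best3: "best_of (\<lambda>vs. choice_code vs < Suc k) s3"
          using best2 f3 by (rule best_of_frame) (simp_all add: increment_def)
        show "I (Suc k) s3"
        proof (cases "nvar s3 ''carry'' = 0")
          case True
          then show ?thesis using 3 d3 best3 sel 1(3) by (simp add: I_def)
        next
          case False
          then have carry: "nvar s3 ''carry'' = 1" using 3 by simp
          \<comment> \<open>With a carry, the counter equation adds \<open>cmax\<close> on the left,
            so \<open>Suc k\<close> has reached \<open>cmax\<close> and exceeds every code.\<close>
          then have "cmax \<le> Suc k" using 3 sel 1(3) by simp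
          then have "choice_code vs < Suc k" for vs using choice_code_less[of vs] by linarith
          then have "best_of (\<lambda>_. True) s3" using best3 by simp
          then show ?thesis using 3 d3 carry by (simp add: I_def)
        qed
      qed
    qed
    ultimately show "k < cmax \<and> run (ptime N (Seq try_ends increment)) (Seq try_ends increment) s1 (I (Suc k))"
      by blast
  next
    have "counter_val in_tree (\<lambda>_. 0) i = 0" for i by (induction i) auto
    then show "I 0 s"
      using data carry found sel by (simp add: I_def binary_def best_of_def)
  qed (auto simp: I_def)
qed

text \<open>Exactly \<open>n - 1\<close> of the fewer than \<open>k + n\<close> edges lie in the
  tree, where \<open>k\<close> is the feedback edge number.\<close>

lemma digits_le: "digits in_tree m \<le> feedback_edge_number E"
proof -
  have "{i. i < m \<and> in_tree i} = te ` {..<n - 1}"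
    using te_less by (auto simp: in_tree_def)
  then have "card {i. i < m \<and> in_tree i} = n - 1"
    using inj_te by (simp add: card_image)
  moreover have "m < feedback_edge_number E + n"
    using card_le_feedback_edge_number[OF graph] n_pos card_E by auto
  ultimately show ?thesis using digits_card[of in_tree m] by linarith
qed

end

section \<open>The whole program: correctness and running time\<close>

context poh_instance
begin

text \<open>\<open>ptime\<close> charges the outermost loop for \<open>N\<close> rounds only. Since
  \<open>1 \<le> N\<close>, multiplying the whole bound by \<open>2 ^ k\<close>, for feedback edge
  number \<open>k\<close>, pays for its at most \<open>2 ^ k\<close> rounds.\<close>

lemma solve_correct:
  "\<exists>t s'. exec (solve cyc) (input_state n es ps c) t s' \<and>
     t \<le> 2 ^ feedback_edge_number E * ptime N (solve cyc) \<and> correct_output problem n E \<pi> c s'"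
proof -
  let ?k = "(2::nat) ^ feedback_edge_number E"
  let ?s = "input_state n es ps c"
  let ?R = "correct_output problem n E \<pi> c"
  have inp: "inp ?s"
    by (auto simp: inp_def input_state_def m_def src_def dst_def ed_def)
  have k: "1 \<le> ?k" by simp
  have N: "1 \<le> N" using n_pos bounds by simp
  let ?main = "Seq (NAssign ''l'' (Pred (NVar ''n'')))
    (Seq (NAssign ''len'' (if cyc then NVar ''n'' else Pred (NVar ''n''))) enumerate_choices)"
  have "prun N grow_tree ?s (\<lambda>s1. grow_inv s1 \<and>
      (nvar s1 ''slot'' = 0 \<or> (\<nexists>vs. hamiltonian_path {..<n} E vs)))"
    using inp by (rule grow_tree_correct) (simp_all add: input_state_def)
  then have "prun N grow_tree ?s (\<lambda>s1. run (?k * ptime N ?main + 1)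
      (Cond (NEq (NVar ''slot'') (Const 0)) ?main Skip) s1 ?R)"
  proof (rule prun_conseq)
    fix s1 assume f1: "frame grow_tree ?s s1" and 1: "grow_inv s1 \<and>
      (nvar s1 ''slot'' = 0 \<or> (\<nexists>vs. hamiltonian_path {..<n} E vs))"
    have vars: "nvar s1 ''found'' = 0" "nvar s1 ''carry'' = 0" "narr s1 ''sel'' = (\<lambda>_. 0)"
      using f1 by (simp_all add: frame_simps grow_tree_def grow_step_def add_edge_def input_state_def)
    show "run (?k * ptime N ?main + 1) (Cond (NEq (NVar ''slot'') (Const 0)) ?main Skip) s1 ?R"
    proof (rule run_Cond)
      assume "bval (NEq (NVar ''slot'') (Const 0)) s1"
      then have "inp s1" and inv: "tree_inv (narr s1 ''vis'') 0 (narr s1 ''te'') (narr s1 ''ch'') (narr s1 ''tree'')"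
        using 1 by (auto simp: grow_inv_def)
      \<comment> \<open>The tree is read off the state in which growing has ended with all slots
        filled.\<close>
      interpret spanned_instance N n es ps E \<pi> c cyc "narr s1 ''te''" "narr s1 ''ch''"
        by unfold_locales (use inv in \<open>auto simp: tree_inv_def\<close>)
      let ?s2 = "step (NAssign ''l'' (Pred (NVar ''n''))) s1"
      let ?s3 = "step (NAssign ''len'' (if cyc then NVar ''n'' else Pred (NVar ''n''))) ?s2"
      have data: "data ?s3"
        using \<open>inp s1\<close> inv by (auto simp: data_def inp_def tree_inv_def in_tree_def atLeast0LessThan)
      let ?B = "ptime N (Seq try_ends increment) + 1"
      have "run (cmax * ?B + 1) enumerate_choices ?s3 (best_of (\<lambda>_. True))"
        by (rule enumerate_choices_correct[OF data]) (use vars in auto)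
      then have "run (cmax * ?B + 1) enumerate_choices ?s3 ?R"
      proof (rule run_conseq)
        fix s' assume best: "best_of (\<lambda>_. True) s'"
        then show "?R s'"
          unfolding correct_output_def best_of_def is_arg_min_def feas_def[symmetric] tcost_def[symmetric]
          by (auto simp: not_less)
      qed simp
      then have "run (ptime N (NAssign ''l'' (Pred (NVar ''n''))) + (ptime N (NAssign ''len''
          (if cyc then NVar ''n'' else Pred (NVar ''n''))) + (cmax * ?B + 1))) ?main s1 ?R"
        by (intro run_step_Seq) simp_all
      \<comment> \<open>The three single units are the two assignments and the final test of the
        loop guard; \<open>ptime N ?main\<close> contains the same three.\<close>
      moreover have "1 + (1 + (cmax * ?B + 1)) \<le> ?k * ptime N ?main"
      proof -
        have "cmax \<le> ?k" using digits_le by simp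
        moreover have "1 * ?B \<le> N * ?B" using N by (rule mult_right_mono) simp
        ultimately have "cmax * ?B \<le> ?k * (N * ?B)" by (intro mult_mono) simp_all
        moreover have "3 \<le> ?k * 3" using k by simp
        moreover have "ptime N ?main = N * ?B + 3" by (simp add: enumerate_choices_def)
        ultimately show ?thesis by (simp only: distrib_left)
      qed
      ultimately show "run (?k * ptime N ?main) ?main s1 ?R"
        by (elim run_conseq) simp_all
    next
      assume "\<not> bval (NEq (NVar ''slot'') (Const 0)) s1"
      then have "\<nexists>vs. hamiltonian_path {..<n} E vs" using 1 by simp
      then have "\<nexists>vs. feas vs" using feas_hamiltonian by blast
      then have "?R s1" using vars by (simp add: correct_output_def feas_def)
      moreover have "1 \<le> ?k * ptime N ?main"
        using k ptime_pos[of N ?main] by (metis mult_le_mono mult_1 Suc_leI One_nat_def)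
      ultimately show "run (?k * ptime N ?main) Skip s1 ?R"
        unfolding run_def using exec.Skip by blast
    qed
  qed
  then have "run (ptime N grow_tree + (?k * ptime N ?main + 1))
      (Seq grow_tree (Cond (NEq (NVar ''slot'') (Const 0)) ?main Skip)) ?s ?R"
    by (rule run_Seq)
  then have "run (ptime N grow_tree + (?k * ptime N ?main + 1) + 1) (solve cyc) ?s ?R"
    unfolding solve_def by (intro run_Cond) (use n_pos in \<open>auto simp: input_state_def\<close>)
  moreover have "ptime N grow_tree + (?k * ptime N ?main + 1) + 1 \<le> ?k * ptime N (solve cyc)"
  proof -
    have "ptime N grow_tree \<le> ?k * ptime N grow_tree" "2 \<le> ?k * 2" using k by simp_all
    moreover have "ptime N (solve cyc) = ptime N grow_tree + ptime N ?main + 2 + 2" by (simp add: solve_def)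
    ultimately show ?thesis by (simp only: distrib_left)
  qed
  ultimately show ?thesis
    unfolding run_def by (meson order_trans)
qed

end

lemma solves_in_time_solve:
  "solves_in_time (solve cyc) (if cyc then MinPOHCP else MinPOHPP)
     (\<lambda>n k. 2 ^ k * ptime (n * n + n) (solve cyc))"
  unfolding solves_in_time_def
proof (intro allI impI)
  fix n E \<pi> c s
  assume asm: "simple_graph {..<n} E \<and> partial_order_on {..<n} \<pi> \<and> encodes s n E \<pi> c"
  then obtain es ps where es: "distinct (map (\<lambda>(u, v). {u, v}) es)"
    "set (map (\<lambda>(u, v). {u, v}) es) = E" and ps: "distinct ps" "set ps = \<pi>"
    and s: "s = input_state n es ps c"
    unfolding encodes_def by blast
  let ?X = "if cyc then MinPOHCP else MinPOHPP"
  show "\<exists>t s'. exec (solve cyc) s t s' \<and>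
    t \<le> 2 ^ feedback_edge_number E * ptime (n * n + n) (solve cyc) \<and> correct_output ?X n E \<pi> c s'"
  proof (cases "n = 0")
    case True
    have t: "exec (solve cyc) s (1 + 1) (s\<lparr>nvar := (nvar s)(''found'' := if cyc then 0 else 1)\<rparr>)"
      unfolding solve_def
      using exec.NAssign[of "''found''" "Const (if cyc then 0 else 1)" s]
      by (intro exec.CondTrue) (auto simp: s True input_state_def)
    have feasible: "feasible MinPOHPP {} E \<pi> vs \<longleftrightarrow> vs = []" "\<not> feasible MinPOHCP {} E \<pi> vs" for vs
      by (auto simp: MinPOHCP_def MinPOHPP_def hamiltonian_path_def extending_def)
    have "1 + 1 \<le> ptime (n * n + n) (solve cyc)" by (simp add: solve_def)
    also have "\<dots> \<le> 2 ^ feedback_edge_number E * ptime (n * n + n) (solve cyc)" by simp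
    finally show ?thesis
      using t True
      by (intro exI conjI) (auto simp: correct_output_def feasible is_arg_min_def)
  next
    case False
    have "card E \<le> n * n"
    proof -
      have "E \<subseteq> (\<lambda>(u, v). {u, v}) ` ({..<n} \<times> {..<n})"
        using asm unfolding simple_graph_def by auto
      then have "card E \<le> card ({..<n} \<times> {..<n})"
        by (rule surj_card_le[rotated]) simp
      then show ?thesis by simp
    qed
    moreover have "card \<pi> \<le> n * n"
    proof -
      have "\<pi> \<subseteq> {..<n} \<times> {..<n}" using asm by (simp add: partial_order_on_def preorder_on_def)
      then have "card \<pi> \<le> card ({..<n} \<times> {..<n})" by (intro card_mono) auto
      then show ?thesis by simp
    qed
    moreover have "card E = length es" "card \<pi> = length ps"
      using es ps distinct_card by (metis length_map)+
    \<comment> \<open>Edges and order pairs number at most \<open>n * n\<close> each; the summand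
      \<open>n\<close> makes \<open>n\<close> itself obviously bounded as well.\<close>
    ultimately interpret poh_instance "n * n + n" n es ps E \<pi> c cyc
      using asm es ps False by unfold_locales auto
    show ?thesis using solve_correct unfolding s problem_def .
  qed
qed

lemma polynomially_bounded_solve: "polynomially_bounded (\<lambda>n. ptime (n * n + n) (solve cyc))"
  by (intro polynomially_bounded_ptime polynomially_bounded_add polynomially_bounded_mult
      polynomially_bounded_id)

theorem theorem3p4:
  shows "(\<exists>P p. polynomially_bounded p \<and> solves_in_time P MinPOHPP (\<lambda>n k. 2 ^ k * p n)) \<and>
         (\<exists>P p. polynomially_bounded p \<and> solves_in_time P MinPOHCP (\<lambda>n k. 2 ^ k * p n))"
  using polynomially_bounded_solve solves_in_time_solve[of False] solves_in_time_solve[of True]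
  by fastforce

end
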